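(* Let $\vec p=(p_1,p_2)$ and $\vec q=(q_1,q_2)$ with $q_1,q_2<\infty$ satisfy $1<p_-\le p_+\le q_-<\infty$, where $p_+:=\max\{p_1,p_2\}$, $p_-:=\min\{p_1,p_2\}$ and $q_-:=\min\{q_1,q_2\}$. Let $\vec a,\vec b,\vec c\in\mathbb R^2$ and $\vec\alpha,\vec\beta\in(-1,\infty)^2$. If the operator $T_{\vec a,\vec b,\vec c}$ is bounded from $L^{\vec p}_{\vec\alpha}$ to $L^{\vec q}_{\vec\beta}$, then for every $i\in\{1,2\}$, $$-q_i a_i<\beta_i+1,\qquad \alpha_i+1<p_i(b_i+1),\qquad c_i=n+a_i+b_i+\frac{n+\beta_i}{q_i}-\frac{n+\alpha_i}{p_i}.$$
   Context: Fix a positive integer $n$. Write $y=(y',y_n)\in\mathbb R^{n-1}\times\mathbb R$. The forward light cone is $\Lambda_n=\{(y',y_n)\in\mathbb R^n: y_n>|y'|\}$, and the tube domain over it is $T_{\Lambda_n}=\{z=x+iy\in\mathbb C^n: x\in\mathbb R^n,\ y\in\Lambda_n\}$. For $y\in\Lambda_n$ put $\mathfrak g(y)=y_n^2-|y'|^2$, and for $z\in T_{\Lambda_n}$ put $Q(z)=z_1^2+\cdots+z_{n-1}^2-z_n^2$, so that $Q(iy)=\mathfrak g(y)>0$ for $y\in\Lambda_n$. For $z,u\in T_{\Lambda_n}$ one has $z-\overline u\in T_{\Lambda_n}$; real powers $Q(\cdot)^c$ on the convex domain $T_{\Lambda_n}$ are taken with the holomorphic branch that is positive on $i\Lambda_n$.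 $dV=dv$ denotes Lebesgue (volume) measure on $T_{\Lambda_n}$, and $dv_\alpha(z)=\mathfrak g(\operatorname{Im}z)^\alpha\,dv(z)$ for $\alpha>-1$. For $\vec p=(p_1,p_2)\in[1,\infty)^2$ and $\vec\alpha=(\alpha_1,\alpha_2)\in(-1,\infty)^2$, $L^{\vec p}_{\vec\alpha}$ is the space of measurable $f$ on $T_{\Lambda_n}\times T_{\Lambda_n}$ with $$\|f\|_{L^{\vec p}_{\vec\alpha}}=\Big\{\int_{T_{\Lambda_n}}\Big[\int_{T_{\Lambda_n}}|f(z,w)|^{p_1}\,dv_{\alpha_1}(z)\Big]^{p_2/p_1}dv_{\alpha_2}(w)\Big\}^{1/p_2}<\infty.$$ For $\vec a=(a_1,a_2)$, $\vec b=(b_1,b_2)$, $\vec c=(c_1,c_2)\in\mathbb R^2$, define $$T_{\vec a,\vec b,\vec c}f(z,w)=\mathfrak g(\operatorname{Im}z)^{a_1}\mathfrak g(\operatorname{Im}w)^{a_2}\int_{T_{\Lambda_n}}\int_{T_{\Lambda_n}}\frac{\mathfrak g(\operatorname{Im}u)^{b_1}\mathfrak g(\operatorname{Im}\eta)^{b_2}}{Q(z-\overline u)^{c_1}Q(w-\overline\eta)^{c_2}}f(u,\eta)\,dV(u)\,dV(\eta).$$ *)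

theory Defs
  imports "HOL-Analysis.Analysis"
begin

text \<open>
  The dimension \<open>n\<close> is \<open>CARD('n)\<close>. The index \<open>k :: 'n\<close> is the distinguished (``last'')
  coordinate, so \<open>y $ k\<close> is \<open>y\<^sub>n\<close> and \<open>y'\<close> consists of the coordinates in \<open>- {k}\<close>.
  If \<open>CARD('n) = 1\<close> then \<open>y'\<close> is empty and the cone is the half-line \<open>y $ k > 0\<close>.
\<close>

definition light_cone :: "'n::finite \<Rightarrow> (real^'n) set" where
  "light_cone k = {y. y $ k > L2_set (($) y) (- {k})}"

definition gform :: "'n::finite \<Rightarrow> real^'n \<Rightarrow> real" where
  "gform k y = (y $ k)\<^sup>2 - (L2_set (($) y) (- {k}))\<^sup>2"

definition Im_vec :: "complex^'n::finite \<Rightarrow> real^'n" where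
  "Im_vec z = (\<chi> i. Im (z $ i))"

definition cnj_vec :: "complex^'n::finite \<Rightarrow> complex^'n" where
  "cnj_vec z = (\<chi> i. cnj (z $ i))"

definition ii_vec :: "real^'n::finite \<Rightarrow> complex^'n" where
  "ii_vec y = (\<chi> i. \<i> * complex_of_real (y $ i))"

definition tube :: "'n::finite \<Rightarrow> (complex^'n) set" where
  "tube k = {z. Im_vec z \<in> light_cone k}"

definition Qform :: "'n::finite \<Rightarrow> complex^'n \<Rightarrow> complex" where
  "Qform k z = (\<Sum>i\<in>- {k}. (z $ i)\<^sup>2) - (z $ k)\<^sup>2"

text \<open>Holomorphy in several variables: the real derivative exists and is complex linear.\<close>

definition holomorphic_vec :: "(complex^'n::finite \<Rightarrow> complex) \<Rightarrow> (complex^'n) set \<Rightarrow> bool" where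
  "holomorphic_vec F S \<longleftrightarrow>
     (\<forall>z\<in>S. \<exists>D. (F has_derivative D) (at z within S) \<and> (\<forall>t v. D (t *s v) = t * D v))"

text \<open>
  \<open>F\<close> is a holomorphic branch of \<open>Q\<^sup>c\<close> on the tube (it comes from a holomorphic logarithm of \<open>Q\<close>)
  and is positive on \<open>\<i>\<Lambda>\<close>. These conditions determine \<open>F\<close> on the tube; there it agrees with the
  principal power, see \<open>Qpow_eq_powr\<close> below.
\<close>

definition is_Qpow :: "'n::finite \<Rightarrow> real \<Rightarrow> (complex^'n \<Rightarrow> complex) \<Rightarrow> bool" where
  "is_Qpow k c F \<longleftrightarrow>
     (\<exists>L. holomorphic_vec L (tube k) \<and>
          (\<forall>z\<in>tube k. exp (L z) = Qform k z \<and> F z = exp (complex_of_real c * L z))) \<and>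
     (\<forall>y\<in>light_cone k. \<exists>r>0. F (ii_vec y) = complex_of_real r)"

definition Qpow :: "'n::finite \<Rightarrow> real \<Rightarrow> complex^'n \<Rightarrow> complex" where
  "Qpow k c = (SOME F. is_Qpow k c F)"

definition vol :: "'n::finite \<Rightarrow> (complex^'n) measure" where
  "vol k = restrict_space lborel (tube k)"

definition wvol :: "'n::finite \<Rightarrow> real \<Rightarrow> (complex^'n) measure" where
  "wvol k \<alpha> = density (vol k) (\<lambda>z. ennreal (gform k (Im_vec z) powr \<alpha>))"

text \<open>Only used with positive exponents, so that \<open>\<infinity>\<close> is mapped to \<open>\<infinity>\<close>.\<close>

definition ennreal_powr :: "ennreal \<Rightarrow> real \<Rightarrow> ennreal" where
  "ennreal_powr x r = (if x = \<infinity> then \<infinity> else ennreal (enn2real x powr r))"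

definition mixed_norm ::
  "'n::finite \<Rightarrow> real^2 \<Rightarrow> real^2 \<Rightarrow> ((complex^'n) \<times> (complex^'n) \<Rightarrow> complex) \<Rightarrow> ennreal" where
  "mixed_norm k p \<alpha> f =
     ennreal_powr
       (\<integral>\<^sup>+ w. ennreal_powr (\<integral>\<^sup>+ z. ennreal (norm (f (z, w)) powr (p $ 1)) \<partial>wvol k (\<alpha> $ 1))
                            (p $ 2 / p $ 1) \<partial>wvol k (\<alpha> $ 2))
       (1 / p $ 2)"

definition mixed_space ::
  "'n::finite \<Rightarrow> real^2 \<Rightarrow> real^2 \<Rightarrow> ((complex^'n) \<times> (complex^'n) \<Rightarrow> complex) set" where
  "mixed_space k p \<alpha> =
     {f \<in> borel_measurable (vol k \<Otimes>\<^sub>M vol k). mixed_norm k p \<alpha> f < \<infinity>}"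

definition T_integrand ::
  "'n::finite \<Rightarrow> real^2 \<Rightarrow> real^2 \<Rightarrow> ((complex^'n) \<times> (complex^'n) \<Rightarrow> complex) \<Rightarrow>
   complex^'n \<Rightarrow> complex^'n \<Rightarrow> complex^'n \<Rightarrow> complex^'n \<Rightarrow> complex" where
  "T_integrand k b c f z w u \<eta> =
     complex_of_real (gform k (Im_vec u) powr (b $ 1) * gform k (Im_vec \<eta>) powr (b $ 2)) /
     (Qpow k (c $ 1) (z - cnj_vec u) * Qpow k (c $ 2) (w - cnj_vec \<eta>)) * f (u, \<eta>)"

definition T_op ::
  "'n::finite \<Rightarrow> real^2 \<Rightarrow> real^2 \<Rightarrow> real^2 \<Rightarrow> ((complex^'n) \<times> (complex^'n) \<Rightarrow> complex) \<Rightarrow>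
   (complex^'n) \<times> (complex^'n) \<Rightarrow> complex" where
  "T_op k a b c f = (\<lambda>(z, w).
     complex_of_real (gform k (Im_vec z) powr (a $ 1) * gform k (Im_vec w) powr (a $ 2)) *
     (LINT \<eta>|vol k. LINT u|vol k. T_integrand k b c f z w u \<eta>))"

text \<open>
  The Bochner integral of a non-integrable function is \<open>0\<close> by convention, so existence of the
  integrals defining \<open>T f\<close> at almost every point has to be part of boundedness. Existence is
  required for the iterated integral only; by Fubini it follows from absolute integrability of
  the integrand over the product.
\<close>

definition T_defined ::
  "'n::finite \<Rightarrow> real^2 \<Rightarrow> real^2 \<Rightarrow> ((complex^'n) \<times> (complex^'n) \<Rightarrow> complex) \<Rightarrow> bool" where
  "T_defined k b c f \<longleftrightarrow>
     (AE (z, w) in vol k \<Otimes>\<^sub>M vol k.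
        (AE \<eta> in vol k. integrable (vol k) (\<lambda>u. T_integrand k b c f z w u \<eta>)) \<and>
        integrable (vol k) (\<lambda>\<eta>. LINT u|vol k. T_integrand k b c f z w u \<eta>))"

definition T_bounded ::
  "'n::finite \<Rightarrow> real^2 \<Rightarrow> real^2 \<Rightarrow> real^2 \<Rightarrow> real^2 \<Rightarrow> real^2 \<Rightarrow> real^2 \<Rightarrow> real^2 \<Rightarrow> bool" where
  "T_bounded k a b c p \<alpha> q \<beta> \<longleftrightarrow>
     (\<exists>C::real. \<forall>f\<in>mixed_space k p \<alpha>.
        T_defined k b c f \<and> T_op k a b c f \<in> mixed_space k q \<beta> \<and>
        mixed_norm k q \<beta> (T_op k a b c f) \<le> ennreal C * mixed_norm k p \<alpha> f)"


subsection \<open>The branch of \<open>Q\<^sup>c\<close> is well defined\<close>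

lemma L2_set_scale: "L2_set (\<lambda>i. r * f i) A = \<bar>r\<bar> * L2_set f A"
  by (simp add: L2_set_def power_mult_distrib sum_distrib_left[symmetric] real_sqrt_mult)

lemma light_cone_add:
  assumes "x \<in> light_cone k" "y \<in> light_cone k" shows "x + y \<in> light_cone k"
proof -
  have "($) (x + y) = (\<lambda>i. x $ i + y $ i)" by auto
  then show ?thesis
    using assms L2_set_triangle_ineq[of "($) x" "($) y" "- {k}"] by (simp add: light_cone_def)
qed

lemma light_cone_scale:
  assumes "x \<in> light_cone k" "r > 0" shows "r *\<^sub>R x \<in> light_cone k"
proof -
  have "($) (r *\<^sub>R x) = (\<lambda>i. r * x $ i)" by auto
  then show ?thesis
    using assms L2_set_scale[of r "($) x" "- {k}"] by (simp add: light_cone_def)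
qed

lemma gform_pos: "y \<in> light_cone k \<Longrightarrow> gform k y > 0"
  by (simp add: light_cone_def gform_def power_strict_mono)

lemma axis_in_light_cone: "axis k 1 \<in> light_cone k"
proof -
  have "L2_set (($) (axis k (1::real))) (- {k}) = 0"
    by (auto simp: L2_set_def axis_def)
  then show ?thesis by (simp add: light_cone_def axis_def)
qed

lemma Im_vec_ii_vec [simp]: "Im_vec (ii_vec y) = y"
  by (simp add: Im_vec_def ii_vec_def vec_eq_iff)

lemma Qform_ii_vec: "Qform k (ii_vec y) = complex_of_real (gform k y)"
  by (simp add: Qform_def ii_vec_def gform_def L2_set_def power_mult_distrib sum_nonneg sum_negf)

lemma diff_cnj_in_tube:
  assumes "z \<in> tube k" "u \<in> tube k" shows "z - cnj_vec u \<in> tube k"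
proof -
  have "Im_vec (z - cnj_vec u) = Im_vec z + Im_vec u"
    by (simp add: Im_vec_def cnj_vec_def vec_eq_iff)
  then show ?thesis using assms light_cone_add by (auto simp: tube_def)
qed

lemma convex_tube: "convex (tube k)"
  unfolding convex_alt
proof (intro ballI allI impI)
  fix x y :: "complex^'a" and u :: real
  assume xy: "x \<in> tube k" "y \<in> tube k" and u: "0 \<le> u \<and> u \<le> 1"
  have eq: "Im_vec ((1 - u) *\<^sub>R x + u *\<^sub>R y) = (1 - u) *\<^sub>R Im_vec x + u *\<^sub>R Im_vec y"
    by (simp add: Im_vec_def vec_eq_iff)
  consider "u = 0" | "u = 1" | "0 < u" "u < 1" using u by linarith
  then show "(1 - u) *\<^sub>R x + u *\<^sub>R y \<in> tube k"
  proof cases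
    case 3
    then show ?thesis using xy eq by (simp add: tube_def light_cone_add light_cone_scale)
  qed (use xy in auto)
qed

lemma Qform_notin_nonpos:
  assumes "z \<in> tube k" shows "Qform k z \<notin> \<real>\<^sub>\<le>\<^sub>0"
proof
  assume "Qform k z \<in> \<real>\<^sub>\<le>\<^sub>0"
  then have re: "Re (Qform k z) \<le> 0" and im: "Im (Qform k z) = 0"
    by (auto simp: complex_nonpos_Reals_iff)
  define x where "x = (\<lambda>i. Re (z $ i))"
  define y where "y = (\<lambda>i. Im (z $ i))"
  define X where "X = (\<Sum>i\<in>- {k}. (x i)\<^sup>2)"
  define Y where "Y = (\<Sum>i\<in>- {k}. (y i)\<^sup>2)"
  have y: "y k > sqrt Y"
    using assms by (simp add: tube_def light_cone_def Im_vec_def L2_set_def y_def Y_def)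
  have Y0: "Y \<ge> 0" and X0: "X \<ge> 0" by (simp_all add: X_def Y_def sum_nonneg)
  have yk: "y k > 0" using y Y0 real_sqrt_ge_zero[of Y] by linarith
  have Yk: "Y < (y k)\<^sup>2"
    using y yk Y0 by (metis real_sqrt_less_iff real_sqrt_abs abs_of_pos)
  have "(x k * y k)\<^sup>2 = (\<Sum>i\<in>- {k}. x i * y i)\<^sup>2"
    using im by (simp add: Qform_def x_def y_def power2_eq_square sum.distrib mult.commute
        sum_distrib_left[symmetric])
  also have "\<dots> \<le> X * Y"
    unfolding X_def Y_def by (rule Cauchy_Schwarz_ineq_sum)
  also have "\<dots> \<le> X * (y k)\<^sup>2"
    using Yk X0 by (intro mult_left_mono) auto
  finally have "(x k)\<^sup>2 \<le> X"
    using yk by (simp add: power_mult_distrib)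
  moreover have "Re (Qform k z) = X - Y - (x k)\<^sup>2 + (y k)\<^sup>2"
    by (simp add: Qform_def X_def Y_def x_def y_def power2_eq_square sum_subtractf)
  ultimately show False using re Yk by simp
qed

lemma Qform_has_derivative:
  "(Qform k has_derivative (\<lambda>v. (\<Sum>i\<in>- {k}. 2 * z $ i * v $ i) - 2 * z $ k * v $ k)) (at z within S)"
  unfolding Qform_def power2_eq_square
  by (rule has_derivative_eq_rhs, (rule derivative_intros bounded_linear.has_derivative[OF bounded_linear_vec_nth])+)
     (simp add: algebra_simps)

lemma holomorphic_Ln_Qform: "holomorphic_vec (\<lambda>z. Ln (Qform k z)) (tube k)"
  unfolding holomorphic_vec_def
proof
  fix z assume z: "z \<in> tube k"
  let ?D = "\<lambda>v. (\<Sum>i\<in>- {k}. 2 * z $ i * v $ i) - 2 * z $ k * v $ k"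
  have "(Ln has_derivative (*) (inverse (Qform k z))) (at (Qform k z))"
    using has_field_derivative_Ln[OF Qform_notin_nonpos[OF z]] by (simp add: has_field_derivative_def)
  then have "((\<lambda>z. Ln (Qform k z)) has_derivative (\<lambda>v. inverse (Qform k z) * ?D v)) (at z within tube k)"
    by (rule has_derivative_compose[OF Qform_has_derivative])
  moreover have "inverse (Qform k z) * ?D (t *s v) = t * (inverse (Qform k z) * ?D v)" for t v
    by (simp add: algebra_simps sum_distrib_left)
  ultimately show "\<exists>D. ((\<lambda>z. Ln (Qform k z)) has_derivative D) (at z within tube k) \<and>
      (\<forall>t v. D (t *s v) = t * D v)" by blast
qed

lemma Qform_powr_ii_vec:
  assumes "y \<in> light_cone k"
  shows "exp (complex_of_real c * Ln (Qform k (ii_vec y))) = complex_of_real (gform k y powr c)"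
  using gform_pos[OF assms] by (simp add: Qform_ii_vec Ln_of_real powr_def exp_of_real[symmetric])

lemma is_Qpow_principal: "is_Qpow k c (\<lambda>z. exp (complex_of_real c * Ln (Qform k z)))"
proof -
  have "exp (Ln (Qform k z)) = Qform k z" if "z \<in> tube k" for z
    using Qform_notin_nonpos[OF that] by (intro exp_Ln) auto
  moreover have "\<exists>r>0. exp (complex_of_real c * Ln (Qform k (ii_vec y))) = complex_of_real r"
    if "y \<in> light_cone k" for y
    using Qform_powr_ii_vec[OF that, of c] gform_pos[OF that]
    by (intro exI[of _ "gform k y powr c"]) auto
  ultimately show ?thesis
    unfolding is_Qpow_def using holomorphic_Ln_Qform by blast
qed

lemma is_Qpow_unique:
  assumes F: "is_Qpow k c F" and z: "z \<in> tube k"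
  shows "F z = exp (complex_of_real c * Ln (Qform k z))"
proof -
  obtain L where hol: "holomorphic_vec L (tube k)"
    and L: "\<And>z. z \<in> tube k \<Longrightarrow> exp (L z) = Qform k z"
    and FL: "\<And>z. z \<in> tube k \<Longrightarrow> F z = exp (complex_of_real c * L z)"
    using F unfolding is_Qpow_def by blast
  define d where "d = (\<lambda>z. L z - Ln (Qform k z))"
  have cont: "continuous_on (tube k) G" if "holomorphic_vec G (tube k)" for G
    using that unfolding holomorphic_vec_def
    by (meson continuous_on_eq_continuous_within has_derivative_continuous)
  have contd: "continuous_on (tube k) d"
    unfolding d_def by (intro continuous_on_diff cont hol holomorphic_Ln_Qform)
  have exp_d: "exp (d z) = 1" if "z \<in> tube k" for z
    using L[OF that] Qform_notin_nonpos[OF that]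
    by (subst d_def, subst exp_diff, subst exp_Ln) auto
  have "d constant_on tube k"
  proof (rule continuous_discrete_range_constant[OF convex_connected[OF convex_tube] contd])
    fix x assume x: "x \<in> tube k"
    show "\<exists>e>0. \<forall>y. y \<in> tube k \<and> d y \<noteq> d x \<longrightarrow> e \<le> norm (d y - d x)"
    proof (intro exI[of _ "2 * pi"] conjI allI impI)
      fix y assume y: "y \<in> tube k \<and> d y \<noteq> d x"
      show "2 * pi \<le> norm (d y - d x)"
      proof (rule ccontr)
        assume "\<not> 2 * pi \<le> norm (d y - d x)"
        then have "\<bar>Im (d y) - Im (d x)\<bar> < 2 * pi"
          using abs_Im_le_cmod[of "d y - d x"] by simp
        moreover have "exp (d y) = exp (d x)" using x y exp_d by simp
        ultimately show False using y exp_complex_eqI by blast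
      qed
    qed simp
  qed
  then obtain m where m: "\<And>z. z \<in> tube k \<Longrightarrow> d z = m"
    by (auto simp: constant_on_def)
  have split: "F z = exp (complex_of_real c * Ln (Qform k z)) * exp (complex_of_real c * m)"
    if "z \<in> tube k" for z
    using m[OF that] FL[OF that] by (simp add: d_def exp_add[symmetric] algebra_simps)
  let ?y = "axis k (1::real)"
  have i: "ii_vec ?y \<in> tube k" by (simp add: tube_def axis_in_light_cone)
  obtain r where r: "r > 0" "F (ii_vec ?y) = complex_of_real r"
    using F axis_in_light_cone unfolding is_Qpow_def by blast
  have "exp (complex_of_real c * m) = complex_of_real (r / gform k ?y powr c)"
    using split[OF i] r Qform_powr_ii_vec[OF axis_in_light_cone, of c k]
      gform_pos[OF axis_in_light_cone, of k]
    by (simp add: field_simps)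
  moreover have "norm (exp (complex_of_real c * m)) = 1"
    using exp_d[OF i] m[OF i] by (auto simp: norm_exp_eq_Re exp_eq_1)
  ultimately have "exp (complex_of_real c * m) = 1"
    using r gform_pos[OF axis_in_light_cone, of k] by (simp add: norm_divide)
  then show ?thesis using split[OF z] by simp
qed

lemma is_Qpow_Qpow: "is_Qpow k c (Qpow k c)"
  unfolding Qpow_def by (rule someI[of "is_Qpow k c", OF is_Qpow_principal])

theorem Qpow_eq_powr:
  assumes "z \<in> tube k" shows "Qpow k c z = Qform k z powr complex_of_real c"
  using is_Qpow_unique[OF is_Qpow_Qpow assms] Qform_notin_nonpos[OF assms]
  by (auto simp: powr_def)

end

theory Submission
  imports Defs
begin

text \<open>
  On tensor products the operator and the mixed norm factor, so boundedness descends to the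
  one-variable operators \<open>S \<phi>(z) = g(Im z)\<^sup>a \<integral> g(Im u)\<^sup>b Q(z - u\<^sup>*)\<^sup>-\<^sup>c \<phi>(u) dV(u)\<close>,
  with \<open>g\<close> the quadratic form and \<open>u\<^sup>*\<close> the conjugate of \<open>u\<close>. The formula for
  \<open>c\<close> follows by testing on the dilates of one function and comparing powers of the dilation factor.
  For \<open>z\<close> near \<open>0\<close> and \<open>u\<close> near \<open>\<i>e\<close> (\<open>e\<close> the unit vector of the distinguished coordinate), or vice versa,
  \<open>Q(z - u\<^sup>*)\<^sup>-\<^sup>c\<close> is close to \<open>1\<close>, so no cancellation occurs in the integral. With \<open>\<phi>\<close> the indicator
  of a ball around \<open>\<i>e\<close>, finiteness of the norm of \<open>S \<phi>\<close> forces \<open>g\<close> to the power \<open>a q + \<beta>\<close> to be integrable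
  near \<open>0\<close>; with \<open>\<phi>\<close> a truncated power of \<open>g\<close> supported near \<open>0\<close>, the bound on \<open>S\<close> forces
  the dual integrability condition on \<open>b\<close>. Finally \<open>g\<close> to the power \<open>s\<close> is not integrable
  near \<open>0\<close> when \<open>s \<le> -1\<close>.
\<close>

section \<open>Real powers of extended nonnegative numbers\<close>

lemma ennreal_powr_ennreal: "x \<ge> 0 \<Longrightarrow> ennreal_powr (ennreal x) r = ennreal (x powr r)"
  by (simp add: ennreal_powr_def)

lemma ennreal_powr_mult:
  assumes "r > 0" shows "ennreal_powr (x * y) r = ennreal_powr x r * ennreal_powr y r"
proof -
  have top: "ennreal_powr (\<infinity> * y) r = ennreal_powr \<infinity> r * ennreal_powr y r" for y
  proof (cases y)
    case (real s)
    then show ?thesis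
      using assms by (cases "s = 0") (auto simp: ennreal_powr_def ennreal_top_mult)
  qed (auto simp: ennreal_powr_def)
  consider "x = \<infinity>" | "y = \<infinity>" | s t where "x = ennreal s" "y = ennreal t" "s \<ge> 0" "t \<ge> 0"
    by (cases x; cases y) auto
  then show ?thesis
  proof cases
    case 2
    then show ?thesis using top[of x] by (simp add: mult.commute)
  next
    case 3
    then show ?thesis
      by (simp add: ennreal_mult[symmetric] ennreal_powr_ennreal powr_mult del: ennreal_mult'')
  qed (use top in simp)
qed

lemma ennreal_powr_powr: "ennreal_powr (ennreal_powr x r) s = ennreal_powr x (r * s)"
  by (simp add: ennreal_powr_def powr_powr)

lemma ennreal_powr_mono: "x \<le> y \<Longrightarrow> r \<ge> 0 \<Longrightarrow> ennreal_powr x r \<le> ennreal_powr y r"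
  by (cases x; cases y) (auto simp: ennreal_powr_def powr_mono2 top_unique)

lemma ennreal_powr_eq_top_iff: "ennreal_powr x r = top \<longleftrightarrow> x = top"
  by (simp add: ennreal_powr_def)

text \<open>True for every \<open>r\<close>: \<open>0 powr r = 0\<close> by convention, and
  \<infinity> goes to \<infinity> by definition.\<close>

lemma ennreal_powr_eq_0_iff: "ennreal_powr x r = 0 \<longleftrightarrow> x = 0"
  by (cases x) (auto simp: ennreal_powr_def)

section \<open>The tube and its volume measure\<close>

text \<open>The factor y_n - |y'| of g(y) = (y_n - |y'|)(y_n + |y'|). It controls the decay of g at
  the boundary of the cone and changes linearly under translation in Im z_n.\<close>

definition height :: "'n::finite \<Rightarrow> complex^'n \<Rightarrow> real" where
  "height k z = Im (z $ k) - L2_set (\<lambda>i. Im (z $ i)) (- {k})"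

lemma L2_set_Im_vec: "L2_set (($) (Im_vec z)) A = L2_set (\<lambda>i. Im (z $ i)) A"
  by (simp add: L2_set_def Im_vec_def)

lemma mem_tube_iff: "z \<in> tube k \<longleftrightarrow> height k z > 0"
  by (simp add: tube_def light_cone_def height_def L2_set_Im_vec) (simp add: Im_vec_def)

lemma gform_Im_vec: "gform k (Im_vec z) = height k z * (Im (z $ k) + L2_set (\<lambda>i. Im (z $ i)) (- {k}))"
  by (simp add: gform_def height_def L2_set_Im_vec) (simp add: Im_vec_def power2_eq_square algebra_simps)

lemma gform_Im_vec_pos: "z \<in> tube k \<Longrightarrow> gform k (Im_vec z) > 0"
  by (simp add: tube_def gform_pos)

lemma continuous_on_height [continuous_intros]:
  "continuous_on S f \<Longrightarrow> continuous_on S (\<lambda>x. height k (f x))"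
  unfolding height_def L2_set_def by (intro continuous_intros)

lemma continuous_on_gform_Im_vec: "continuous_on S (\<lambda>z. gform k (Im_vec z))"
  unfolding gform_Im_vec height_def L2_set_def by (intro continuous_intros)

lemma open_tube: "open (tube k)"
proof -
  have "tube k = {z. 0 < height k z}" by (auto simp: mem_tube_iff)
  then show ?thesis
    by (simp add: open_Collect_less continuous_on_height continuous_on_const continuous_on_id)
qed

lemma tube_borel [measurable, simp]: "tube k \<in> sets borel"
  by (intro borel_open open_tube)

lemma space_vol [simp]: "space (vol k) = tube k"
  by (simp add: vol_def space_restrict_space)

lemma sets_vol: "sets (vol k) = sets (restrict_space borel (tube k))"
  unfolding vol_def by (intro sets_restrict_space_cong) simp

lemma borel_measurable_vol: "f \<in> borel_measurable borel \<Longrightarrow> f \<in> borel_measurable (vol k)"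
  by (simp add: vol_def measurable_restrict_space1)

lemma borel_measurable_vol_continuous:
  "continuous_on (tube k) f \<Longrightarrow> f \<in> borel_measurable (vol k)"
  using borel_measurable_continuous_on_restrict[of "tube k" f]
  by (simp add: measurable_cong_sets[OF sets_vol refl])

lemma gform_measurable [measurable]: "(\<lambda>z. gform k (Im_vec z)) \<in> borel_measurable (vol k)"
  by (intro borel_measurable_vol_continuous continuous_on_gform_Im_vec)

lemma indicator_vol_measurable:
  "A \<in> sets borel \<Longrightarrow> (indicator A :: _ \<Rightarrow> 'b::{real_normed_algebra_1,second_countable_topology}) \<in> borel_measurable (vol k)"
  by (intro borel_measurable_vol) simp

lemma nn_integral_vol: "(\<integral>\<^sup>+z. f z \<partial>vol k) = (\<integral>\<^sup>+z. f z * indicator (tube k) z \<partial>lborel)"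
  unfolding vol_def by (subst nn_integral_restrict_space) auto

lemma nn_integral_wvol:
  assumes "f \<in> borel_measurable (vol k)"
  shows "(\<integral>\<^sup>+z. f z \<partial>wvol k \<alpha>) = (\<integral>\<^sup>+z. ennreal (gform k (Im_vec z) powr \<alpha>) * f z \<partial>vol k)"
  unfolding wvol_def using assms by (subst nn_integral_density) auto

lemma measurable_wvol [simp]: "measurable (wvol k \<alpha>) N = measurable (vol k) N"
  by (intro measurable_cong_sets) (auto simp: wvol_def)

lemma emeasure_vol: "A \<in> sets borel \<Longrightarrow> A \<subseteq> tube k \<Longrightarrow> emeasure (vol k) A = emeasure lborel A"
  unfolding vol_def by (subst emeasure_restrict_space) auto

lemma sigma_finite_vol: "sigma_finite_measure (vol k)"
  unfolding vol_def
  by (intro sigma_finite_measure_restrict_space sigma_finite_lborel) auto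

section \<open>Regularity of the kernel\<close>

text \<open>By uniqueness of the branch, \<open>Qpow\<close> is the principal power on the tube,
  where \<open>Qform\<close> avoids the cut of \<open>Ln\<close>.\<close>

lemma continuous_on_Qpow: "continuous_on (tube k) (Qpow k c)"
proof -
  have "continuous_on (tube k) (\<lambda>z. exp (complex_of_real c * Ln (Qform k z)))"
    unfolding Qform_def
    by (intro continuous_intros) (use Qform_notin_nonpos in \<open>auto simp: Qform_def\<close>)
  then show ?thesis
    by (rule continuous_on_eq) (simp add: is_Qpow_unique[OF is_Qpow_Qpow])
qed

lemma Qpow_nonzero: "z \<in> tube k \<Longrightarrow> Qpow k c z \<noteq> 0"
  by (simp add: is_Qpow_unique[OF is_Qpow_Qpow])

text \<open>The difference \<open>z - cnj_vec u\<close> stays in the tube, so it is measurable as a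
  map into \<open>vol k\<close> and can be composed with \<open>Qpow\<close>, whose continuity is
  known on the tube.\<close>

lemma Qpow_kernel_measurable [measurable]:
  "(\<lambda>(z, u). Qpow k c (z - cnj_vec u)) \<in> borel_measurable (vol k \<Otimes>\<^sub>M vol k)"
proof -
  have *: "(\<lambda>x. x) \<in> measurable (vol k) borel"
    by (intro borel_measurable_vol) simp
  have "cnj_vec \<in> borel_measurable borel"
    unfolding cnj_vec_def by (intro borel_measurable_continuous_onI continuous_intros)
  then have "(\<lambda>x. fst x - cnj_vec (snd x)) \<in> borel_measurable (vol k \<Otimes>\<^sub>M vol k)"
    by (intro borel_measurable_diff measurable_compose[OF measurable_fst *]
        measurable_compose[OF measurable_compose[OF measurable_snd *]])
  then have "(\<lambda>x. fst x - cnj_vec (snd x)) \<in> measurable (vol k \<Otimes>\<^sub>M vol k) (vol k)"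
    by (subst measurable_cong_sets[OF refl sets_vol], intro measurable_restrict_space2)
       (auto simp: space_pair_measure intro: diff_cnj_in_tube)
  from measurable_compose[OF this borel_measurable_vol_continuous[OF continuous_on_Qpow]]
  show ?thesis by (simp add: case_prod_beta')
qed

section \<open>Dilations\<close>

lemma Im_vec_scaleR: "Im_vec (r *\<^sub>R z) = r *\<^sub>R Im_vec z"
  by (simp add: Im_vec_def vec_eq_iff)

lemma tube_scaleR: "r > 0 \<Longrightarrow> r *\<^sub>R z \<in> tube k \<longleftrightarrow> z \<in> tube k"
  using light_cone_scale[of "Im_vec z" k r] light_cone_scale[of "r *\<^sub>R Im_vec z" k "inverse r"]
  by (auto simp: tube_def Im_vec_scaleR)

lemma gform_scaleR: "gform k (r *\<^sub>R y) = r\<^sup>2 * gform k y"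
proof -
  have "($) (r *\<^sub>R y) = (\<lambda>i. r * y $ i)" by auto
  then show ?thesis
    by (simp add: gform_def L2_set_scale power_mult_distrib algebra_simps)
qed

lemma gform_scaleR_powr:
  assumes "r > 0" "z \<in> tube k"
  shows "gform k (Im_vec (r *\<^sub>R z)) powr s = r powr (2 * s) * gform k (Im_vec z) powr s"
  using assms gform_Im_vec_pos[OF assms(2)]
  by (simp add: Im_vec_scaleR gform_scaleR powr_mult powr_powr flip: powr_numeral)

text \<open>\<open>Qform\<close> is homogeneous of degree 2, and a positive real factor may be
  pulled out of a principal power.\<close>

lemma Qpow_scaleR:
  assumes "r > 0" "z \<in> tube k"
  shows "Qpow k c (r *\<^sub>R z) = complex_of_real (r powr (2 * c)) * Qpow k c z"
proof -
  have "Qform k (r *\<^sub>R z) = complex_of_real (r\<^sup>2) * Qform k z"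
    by (simp add: Qform_def scaleR_conv_of_real[where 'a = complex] power_mult_distrib sum_distrib_left algebra_simps)
  then show ?thesis
    using assms Qform_notin_nonpos[OF assms(2)] unfolding Qpow_eq_powr[OF assms(2)]
    by (subst Qpow_eq_powr)
       (auto simp: tube_scaleR powr_times_real_left powr_of_real powr_powr simp flip: of_real_power powr_numeral)
qed

lemma cnj_vec_scaleR: "cnj_vec (r *\<^sub>R z) = r *\<^sub>R cnj_vec z"
  by (simp add: cnj_vec_def vec_eq_iff)

lemma scaleR_measurable_vol: "r > 0 \<Longrightarrow> (\<lambda>z. r *\<^sub>R z) \<in> measurable (vol k) (vol k)"
  by (subst measurable_cong_sets[OF refl sets_vol], intro measurable_restrict_space2 borel_measurable_vol)
     (auto simp: tube_scaleR)

text \<open>Change of variables: the tube is invariant under dilation, and the exponent is the real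
  dimension 2n of C^n. As an identity of measures it serves nonnegative and Bochner integrals
  alike.\<close>

lemma vol_scaleR:
  fixes k :: "'n::finite"
  assumes "r > 0"
  shows "vol k = density (distr (vol k) (vol k) (\<lambda>z. r *\<^sub>R z)) (\<lambda>_. ennreal (r ^ (2 * CARD('n))))"
    (is "_ = ?D")
proof (rule measure_eqI)
  note * = scaleR_measurable_vol[OF assms, of k]
  fix A assume A: "A \<in> sets (vol k)"
  then have A': "A \<in> sets borel" "A \<subseteq> tube k"
    by (auto simp: sets_vol sets_restrict_space_iff)
  let ?B = "(\<lambda>z. r *\<^sub>R z) -` A"
  have B: "?B \<in> sets borel" "?B \<subseteq> tube k"
    using A' assms measurable_sets[of "\<lambda>z. r *\<^sub>R z" borel borel A]
    by (auto simp: tube_scaleR)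
  have "emeasure ?D A = ennreal (r ^ (2 * CARD('n))) * emeasure (vol k) ?B"
    using A * B by (simp add: emeasure_density emeasure_distr nn_integral_cmult Int_absorb2)
  also have "\<dots> = ennreal (r ^ (2 * CARD('n))) * emeasure lborel ?B"
    using B by (simp add: emeasure_vol)
  also have "\<dots> = emeasure lborel A"
    using assms A'
    by (subst (2) lborel_affine[of r 0])
       (simp_all add: emeasure_density emeasure_distr nn_integral_cmult nn_integral_multc mult.commute)
  finally show "emeasure (vol k) A = emeasure ?D A" using A' by (simp add: emeasure_vol)
qed simp

lemma nn_integral_vol_scaleR:
  fixes k :: "'n::finite"
  assumes "r > 0" "f \<in> borel_measurable (vol k)"
  shows "(\<integral>\<^sup>+z. f z \<partial>vol k) = ennreal (r ^ (2 * CARD('n))) * (\<integral>\<^sup>+z. f (r *\<^sub>R z) \<partial>vol k)"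
  using assms scaleR_measurable_vol[OF assms(1), of k]
  by (subst vol_scaleR[OF assms(1)]) (simp add: nn_integral_density nn_integral_distr nn_integral_cmult)

lemma integral_vol_scaleR:
  fixes k :: "'n::finite" and f :: "complex^'n \<Rightarrow> complex"
  assumes "r > 0" "f \<in> borel_measurable (vol k)"
  shows "(LINT z|vol k. f z) = of_real (r ^ (2 * CARD('n))) * (LINT z|vol k. f (r *\<^sub>R z))"
  using assms scaleR_measurable_vol[OF assms(1), of k]
  by (subst vol_scaleR[OF assms(1)])
     (simp add: integral_density integral_distr scaleR_conv_of_real[where 'a = complex])

lemma emeasure_lborel_open_pos:
  fixes S :: "'a::euclidean_space set"
  assumes "open S" "S \<noteq> {}" shows "emeasure lborel S > 0"
proof (rule ccontr)
  assume "\<not> ?thesis"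
  then have "S \<in> null_sets lborel" using assms by (intro null_setsI) auto
  then have "negligible S" by (simp add: negligible_iff_null_sets null_sets_completionI)
  then show False using open_not_negligible assms by blast
qed

lemma ennreal_eq_top_of_nat_mult_le:
  fixes x v :: ennreal
  assumes "v > 0" and le: "\<And>N. of_nat N * v \<le> x"
  shows "x = top"
proof (rule ccontr)
  assume "x \<noteq> top"
  then obtain y where y: "x = ennreal y" "y \<ge> 0" by (cases x) auto
  have "v \<noteq> top" using le[of 1] \<open>x \<noteq> top\<close> by (auto simp: top_unique)
  then obtain r where r: "v = ennreal r" "r \<ge> 0" by (cases v) auto
  have "real N * r \<le> y" for N
    using le[of N] y r by (simp add: ennreal_of_nat_eq_real_of_nat flip: ennreal_mult)
  moreover have "r > 0" using assms(1) r by (simp add: ennreal_less_zero_iff)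
  ultimately show False using reals_Archimedean3[of r] by (meson leD)
qed

lemma axis_nth_offdiag: "i \<noteq> k \<Longrightarrow> axis k x $ i = 0"
  by (simp add: axis_def)

subsection \<open>Divergence of the weight near the boundary\<close>

text \<open>The bounds are on Re z_n, on z' and on \<open>height\<close> instead of Im z_n, so that
  translating in Im z_n carries slabs to slabs. Heights lie in a half-open interval, so slabs over
  adjacent intervals are disjoint and leave no gap.\<close>

definition slab :: "'n::finite \<Rightarrow> real \<Rightarrow> real \<Rightarrow> real \<Rightarrow> (complex^'n) set" where
  "slab k e s t = {z. \<bar>Re (z $ k)\<bar> < e \<and> (\<forall>i\<in>-{k}. norm (z $ i) < e) \<and> s < height k z \<and> height k z \<le> t}"

lemma height_measurable [measurable]: "height k \<in> borel_measurable borel"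
  by (intro borel_measurable_continuous_onI continuous_on_height continuous_on_id)

lemma slab_borel [measurable, simp]: "slab k e s t \<in> sets borel"
proof -
  have "slab k e s t = {z. \<bar>Re (z $ k)\<bar> < e} \<inter> (\<Inter>i\<in>-{k}. {z. norm (z $ i) < e}) \<inter>
      {z. s < height k z} \<inter> {z. height k z \<le> t}"
    by (auto simp: slab_def)
  moreover have "open {z::complex^'a. \<bar>Re (z $ k)\<bar> < e}" "open (\<Inter>i\<in>-{k}. {z::complex^'a. norm (z $ i) < e})"
     "open {z. s < height k z}" "closed {z. height k z \<le> t}"
    by (intro open_Collect_less open_INT closed_Collect_le continuous_intros ballI; simp)+
  ultimately show ?thesis by (auto intro!: sets.Int borel_open borel_closed simp del: sets.empty_sets)
qed

lemma height_add_axis: "height k (complex_of_real t *s axis k \<i> + z) = height k z + t"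
proof -
  have "L2_set (\<lambda>i. Im ((complex_of_real t *s axis k \<i> + z) $ i)) (- {k}) = L2_set (\<lambda>i. Im (z $ i)) (- {k})"
    by (intro L2_set_cong) (auto simp: axis_def)
  then show ?thesis by (simp add: height_def axis_def)
qed

lemma emeasure_slab_translate:
  "emeasure lborel (slab k e (s + t) (s' + t)) = emeasure lborel (slab k e s s')"
proof -
  let ?c = "complex_of_real t *s axis k \<i>"
  have "(+) ?c -` slab k e (s + t) (s' + t) = slab k e s s'"
    by (auto simp: slab_def height_add_axis axis_nth_offdiag)
  then show ?thesis
    by (subst lborel_distr_plus[symmetric, of ?c]) (simp add: emeasure_distr)
qed

lemma emeasure_slab_pos:
  assumes "e > 0" "t > 0" shows "emeasure lborel (slab k e 0 t) > 0"
proof -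
  \<comment> \<open>The slab without its upper face is open, and it contains the point of height t/2
    whose only nonzero coordinate is z_n = i t/2.\<close>
  let ?U = "{z. \<bar>Re (z $ k)\<bar> < e} \<inter> (\<Inter>i\<in>-{k}. {z. norm (z $ i) < e}) \<inter>
      {z. 0 < height k z} \<inter> {z. height k z < t}"
  have "open {z::complex^'a. \<bar>Re (z $ k)\<bar> < e}" "open (\<Inter>i\<in>-{k}. {z::complex^'a. norm (z $ i) < e})"
     "open {z. 0 < height k z}" "open {z. height k z < t}"
    by (intro open_Collect_less open_INT continuous_intros ballI; simp)+
  then have "open ?U" by auto
  moreover have "complex_of_real (t / 2) *s axis k \<i> + 0 \<in> ?U"
  proof -
    have "height k (complex_of_real (t / 2) *s axis k \<i> + 0) = t / 2"
      unfolding height_add_axis by (simp add: height_def L2_set_def)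
    moreover have "norm ((complex_of_real (t / 2) *s axis k \<i> + 0) $ i) < e" if "i \<noteq> k" for i
      using that assms by (simp add: axis_def)
    ultimately show ?thesis using assms by (simp add: axis_def)
  qed
  ultimately have "emeasure lborel ?U > 0" by (intro emeasure_lborel_open_pos) blast+
  also have "emeasure lborel ?U \<le> emeasure lborel (slab k e 0 t)"
    by (rule emeasure_mono) (use slab_borel[of k e 0 t] in \<open>auto simp: slab_def\<close>)
  finally show ?thesis .
qed

text \<open>
  Translation along the imaginary axis of the distinguished coordinate shows that the volume of a
  slab is proportional to its thickness; hence each dyadic slab contributes equally to the integral.
\<close>

lemma nn_integral_inverse_height:
  assumes "e > 0" "t > 0"
  shows "(\<integral>\<^sup>+z. indicator (slab k e 0 t) z * ennreal (1 / height k z) \<partial>lborel) = \<infinity>"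
proof -
  define J where "J = (\<lambda>t. \<integral>\<^sup>+z. indicator (slab k e 0 t) z * ennreal (1 / height k z) \<partial>lborel)"
  define m where "m = (\<lambda>t. emeasure lborel (slab k e 0 t))"
  \<comment> \<open>Volume over thickness; since \<open>m\<close> doubles with its argument,
    \<open>W\<close> is invariant under doubling.\<close>
  define W where "W = (\<lambda>t. ennreal (1 / t) * m t)"
  have shift: "emeasure lborel (slab k e s (2 * s)) = m s" for s
    using emeasure_slab_translate[of k e 0 s s] unfolding m_def mult_2 add_0 .
  have split: "slab k e 0 (2 * s) = slab k e 0 s \<union> slab k e s (2 * s)" 
      "slab k e 0 s \<inter> slab k e s (2 * s) = {}" if "s > 0" for s
    using that by (auto simp: slab_def)
  have m2: "m (2 * s) = 2 * m s" if "s > 0" for s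
  proof -
    have "m (2 * s) = emeasure lborel (slab k e 0 s) + emeasure lborel (slab k e s (2 * s))"
      unfolding m_def split(1)[OF that] by (rule plus_emeasure[symmetric]) (simp_all add: split(2)[OF that])
    then show ?thesis unfolding shift by (simp only: m_def mult_2)
  qed
  have W2: "W (2 * s) = W s" if "s > 0" for s
  proof -
    have "W (2 * s) = (ennreal (1 / (2 * s)) * ennreal 2) * m s"
      using m2[OF that] by (simp add: W_def mult.assoc)
    also have "ennreal (1 / (2 * s)) * ennreal 2 = ennreal (1 / s)"
      using that by (subst ennreal_mult[symmetric]) auto
    finally show ?thesis by (simp add: W_def)
  qed
  \<comment> \<open>The upper half of the slab has volume \<open>m s\<close>, and 1/height is at
    least 1/(2s) on it. This contributes m(s)/(2s), which is half of \<open>W s\<close>.\<close>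
  have J2: "J (2 * s) \<ge> J s + ennreal (1 / 2) * W s" if "s > 0" for s
  proof -
    have "ennreal (1 / 2) * W s = (ennreal (1 / 2) * ennreal (1 / s)) * m s"
      by (simp add: W_def mult.assoc)
    also have "ennreal (1 / 2) * ennreal (1 / s) = ennreal (1 / (2 * s))"
      using that by (subst ennreal_mult[symmetric]) auto
    also have "\<dots> * m s = (\<integral>\<^sup>+z. indicator (slab k e s (2 * s)) z * ennreal (1 / (2 * s)) \<partial>lborel)"
      by (subst nn_integral_multc) (simp_all add: shift mult.commute[of "m s"])
    finally have "J s + ennreal (1 / 2) * W s = (\<integral>\<^sup>+z. indicator (slab k e 0 s) z * ennreal (1 / height k z) +
        indicator (slab k e s (2 * s)) z * ennreal (1 / (2 * s)) \<partial>lborel)"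
      unfolding J_def by (subst nn_integral_add) auto
    also have "\<dots> \<le> J (2 * s)"
      unfolding J_def
    proof (intro nn_integral_mono)
      fix z :: "complex^'a"
      have "ennreal (1 / (2 * s)) \<le> ennreal (1 / height k z)" if "z \<in> slab k e s (2 * s)"
        using that \<open>s > 0\<close> by (intro ennreal_leI divide_left_mono) (auto simp: slab_def)
      then show "indicator (slab k e 0 s) z * ennreal (1 / height k z) +
          indicator (slab k e s (2 * s)) z * ennreal (1 / (2 * s))
          \<le> indicator (slab k e 0 (2 * s)) z * ennreal (1 / height k z)"
        using split[OF \<open>s > 0\<close>] by (auto simp: indicator_def)
    qed
    finally show ?thesis .
  qed
  have W: "W (t / 2 ^ N) = W t" for N
  proof (induction N)
    case (Suc N)
    then show ?case using W2[of "t / 2 ^ Suc N"] assms by simp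
  qed simp
  \<comment> \<open>Halving N times yields N equal contributions. The remainder
    \<open>J (t / 2 ^ N)\<close> is kept so that the induction can split it again.\<close>
  have *: "J t \<ge> of_nat N * (ennreal (1 / 2) * W t) + J (t / 2 ^ N)" for N
  proof (induction N)
    case (Suc N)
    have "J (t / 2 ^ N) \<ge> J (t / 2 ^ Suc N) + ennreal (1 / 2) * W t"
      using J2[of "t / 2 ^ Suc N"] W[of "Suc N"] assms by simp
    then have "of_nat N * (ennreal (1 / 2) * W t) + (J (t / 2 ^ Suc N) + ennreal (1 / 2) * W t) \<le> J t"
      using Suc.IH by (meson add_left_mono order_trans)
    then show ?case by (simp add: algebra_simps)
  qed simp
  have "ennreal (1 / 2) * W t > 0"
    using emeasure_slab_pos[OF assms, of k] assms
    unfolding W_def m_def ennreal_zero_less_mult_iff ennreal_less_zero_iff by simp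
  moreover have "of_nat N * (ennreal (1 / 2) * W t) \<le> J t" for N
    by (rule order_trans[OF _ *[of N]]) (simp add: add_increasing2)
  ultimately have "J t = top" by (rule ennreal_eq_top_of_nat_mult_le)
  then show ?thesis by (simp add: J_def)
qed

text \<open>On a small slab at 0 the factor y_n + |y'| is at most 1, so g \<le> height and g \<le>
  1. Hence g^s \<ge> 1/g \<ge> 1/height for s \<le> -1, and the divergence of the integral of
  1/height carries over.\<close>

lemma nn_integral_gform_powr_eq_top:
  fixes k :: "'n::finite"
  assumes "d > 0" "s \<le> -1"
  shows "(\<integral>\<^sup>+z. indicator (ball 0 d) z * ennreal (gform k (Im_vec z) powr s) \<partial>vol k) = \<infinity>"
proof -
  \<comment> \<open>In the slab, |y'| \<le> n e and Im z_n \<le> (n + 1) e, so |z| \<le> (2n + 2) e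
    and y_n + |y'| \<le> (2n + 1) e. Dividing by 2n + 3 puts the first strictly below d and the
    second below 1.\<close>
  define e where "e = min d 1 / (2 * real CARD('n) + 3)"
  have "(2 * real CARD('n) + 3) * e = min d 1" by (simp add: e_def)
  moreover have "e > 0" using assms by (simp add: e_def add_nonneg_pos)
  ultimately have e: "e > 0" "(2 * real CARD('n) + 2) * e < d" "(2 * real CARD('n) + 2) * e \<le> 1" 
    by (auto simp: algebra_simps)
  have "\<infinity> = (\<integral>\<^sup>+z. indicator (slab k e 0 e) z * ennreal (1 / height k z) \<partial>lborel)"
    using nn_integral_inverse_height[OF e(1) e(1), of k] by simp
  also have "\<dots> \<le> (\<integral>\<^sup>+z. indicator (ball 0 d) z * ennreal (gform k (Im_vec z) powr s) * indicator (tube k) z \<partial>lborel)"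
  proof (intro nn_integral_mono)
    fix z :: "complex^'n"
    show "indicator (slab k e 0 e) z * ennreal (1 / height k z)
      \<le> indicator (ball 0 d) z * ennreal (gform k (Im_vec z) powr s) * indicator (tube k) z"
    proof (cases "z \<in> slab k e 0 e")
      case True
      let ?l = "L2_set (\<lambda>i. Im (z $ i)) (- {k})"
      have h: "0 < height k z" "height k z \<le> e" and rk: "\<bar>Re (z $ k)\<bar> < e"
        and zi: "\<And>i. i \<noteq> k \<Longrightarrow> norm (z $ i) < e"
        using True by (auto simp: slab_def)
      have card: "real (card (- {k})) * e \<le> real CARD('n) * e"
        using e(1) by (intro mult_right_mono) (auto intro: card_mono)
      have "?l \<le> (\<Sum>i\<in>-{k}. \<bar>Im (z $ i)\<bar>)" by (rule L2_set_le_sum_abs)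
      also have "\<dots> \<le> (\<Sum>i\<in>-{k}. e)"
        by (intro sum_mono order_trans[OF abs_Im_le_cmod]) (auto intro: less_imp_le zi)
      finally have l: "?l \<le> real CARD('n) * e" using card by simp
      have l0: "?l \<ge> 0" by (rule L2_set_nonneg)
      have Imk: "0 < Im (z $ k)" "Im (z $ k) \<le> e + real CARD('n) * e"
        using h l l0 unfolding height_def by linarith+
      have "norm z \<le> (\<Sum>i\<in>UNIV. norm (z $ i))"
        unfolding norm_vec_def by (rule L2_set_le_sum) simp
      also have "\<dots> = norm (z $ k) + (\<Sum>i\<in>-{k}. norm (z $ i))"
        by (subst sum.remove[of _ k]) (auto simp: Compl_eq_Diff_UNIV)
      also have "(\<Sum>i\<in>-{k}. norm (z $ i)) \<le> (\<Sum>i\<in>-{k}. e)"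
        using zi by (intro sum_mono) (auto intro: less_imp_le)
      also have "\<dots> \<le> real CARD('n) * e" using card by simp
      also have "norm (z $ k) \<le> e + (e + real CARD('n) * e)"
        using cmod_le[of "z $ k"] rk Imk by linarith
      finally have "norm z < d" using e(2) by (simp add: algebra_simps)
      moreover have z: "z \<in> tube k" using h by (simp add: mem_tube_iff)
      moreover have "1 / height k z \<le> gform k (Im_vec z) powr s"
      proof -
        have "Im (z $ k) + ?l \<le> 1" using Imk l e by (simp add: algebra_simps)
        then have g: "gform k (Im_vec z) \<le> height k z"
          using h unfolding gform_Im_vec by (simp add: mult_left_le)
        have "e \<le> (2 * real CARD('n) + 2) * e" using e(1) by simp
        then have g1: "gform k (Im_vec z) \<le> 1" using g h e by linarith
        have g0: "gform k (Im_vec z) > 0" using gform_Im_vec_pos[OF z] .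
        have "1 / height k z \<le> 1 / gform k (Im_vec z)"
          using g g0 by (intro divide_left_mono) auto
        also have "\<dots> = gform k (Im_vec z) powr (- 1)"
          using g0 by (simp add: powr_minus_divide)
        also have "\<dots> \<le> gform k (Im_vec z) powr s"
          using g0 g1 assms(2) by (intro powr_mono') auto
        finally show ?thesis .
      qed
      ultimately show ?thesis by (simp add: True ennreal_leI)
    qed simp
  qed
  also have "\<dots> = (\<integral>\<^sup>+z. indicator (ball 0 d) z * ennreal (gform k (Im_vec z) powr s) \<partial>vol k)"
    by (simp add: nn_integral_vol)
  finally show ?thesis by (simp add: top_unique)
qed

subsection \<open>The one-variable operator\<close>

definition lnorm :: "'n::finite \<Rightarrow> real \<Rightarrow> real \<Rightarrow> (complex^'n \<Rightarrow> complex) \<Rightarrow> ennreal" where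
  "lnorm k p \<alpha> \<phi> = ennreal_powr (\<integral>\<^sup>+z. ennreal (norm (\<phi> z) powr p) \<partial>wvol k \<alpha>) (1 / p)"

definition S_op ::
  "'n::finite \<Rightarrow> real \<Rightarrow> real \<Rightarrow> real \<Rightarrow> (complex^'n \<Rightarrow> complex) \<Rightarrow> complex^'n \<Rightarrow> complex" where
  "S_op k a b c \<phi> z = complex_of_real (gform k (Im_vec z) powr a) *
     (LINT u|vol k. complex_of_real (gform k (Im_vec u) powr b) / Qpow k c (z - cnj_vec u) * \<phi> u)"

lemma lnorm_cong: "(\<And>z. z \<in> tube k \<Longrightarrow> \<phi> z = \<psi> z) \<Longrightarrow> lnorm k p \<alpha> \<phi> = lnorm k p \<alpha> \<psi>"
  unfolding lnorm_def by (intro arg_cong2[where f = ennreal_powr] nn_integral_cong) (auto simp: wvol_def)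

lemma lnorm_cmult:
  assumes [measurable]: "\<phi> \<in> borel_measurable (vol k)" and "x \<ge> 0" "p > 0"
  shows "lnorm k p \<alpha> (\<lambda>z. complex_of_real x * \<phi> z) = ennreal x * lnorm k p \<alpha> \<phi>"
proof -
  have "(\<integral>\<^sup>+z. ennreal (norm (complex_of_real x * \<phi> z) powr p) \<partial>wvol k \<alpha>) =
      ennreal (x powr p) * (\<integral>\<^sup>+z. ennreal (norm (\<phi> z) powr p) \<partial>wvol k \<alpha>)"
    using assms(2) by (subst nn_integral_cmult[symmetric])
      (simp_all add: norm_mult powr_mult ennreal_mult)
  then show ?thesis
    using assms by (simp add: lnorm_def ennreal_powr_mult ennreal_powr_ennreal powr_powr)
qed

text \<open>The inner integral releases |\<psi>(w)| to the power p_1, which the outer exponent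
  p_2/p_1 turns into the power p_2.\<close>

lemma mixed_norm_tensor:
  assumes [measurable]: "\<phi> \<in> borel_measurable (vol k)" "\<psi> \<in> borel_measurable (vol k)"
    and p: "p $ 1 > 0" "p $ 2 > 0"
  shows "mixed_norm k p \<alpha> (\<lambda>(z, w). \<phi> z * \<psi> w) =
    lnorm k (p $ 1) (\<alpha> $ 1) \<phi> * lnorm k (p $ 2) (\<alpha> $ 2) \<psi>"
proof -
  let ?A = "\<integral>\<^sup>+z. ennreal (norm (\<phi> z) powr (p $ 1)) \<partial>wvol k (\<alpha> $ 1)"
  have inner: "ennreal_powr (\<integral>\<^sup>+z. ennreal (norm (\<phi> z * \<psi> w) powr (p $ 1)) \<partial>wvol k (\<alpha> $ 1)) (p $ 2 / p $ 1) =
      ennreal_powr ?A (p $ 2 / p $ 1) * ennreal (norm (\<psi> w) powr (p $ 2))" for w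
  proof -
    have "(\<integral>\<^sup>+z. ennreal (norm (\<phi> z * \<psi> w) powr (p $ 1)) \<partial>wvol k (\<alpha> $ 1)) =
        ?A * ennreal (norm (\<psi> w) powr (p $ 1))"
      by (subst nn_integral_multc[symmetric]) (simp_all add: norm_mult powr_mult ennreal_mult)
    then show ?thesis
      using p by (simp add: ennreal_powr_mult ennreal_powr_ennreal powr_powr)
  qed
  have "(\<integral>\<^sup>+w. ennreal_powr ?A (p $ 2 / p $ 1) * ennreal (norm (\<psi> w) powr (p $ 2)) \<partial>wvol k (\<alpha> $ 2)) =
      ennreal_powr ?A (p $ 2 / p $ 1) * (\<integral>\<^sup>+w. ennreal (norm (\<psi> w) powr (p $ 2)) \<partial>wvol k (\<alpha> $ 2))"
    by (subst nn_integral_cmult) simp_all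
  then show ?thesis
    using p unfolding mixed_norm_def lnorm_def
    by (simp add: inner ennreal_powr_mult ennreal_powr_powr)
qed

text \<open>Constants leave a Bochner integral unconditionally: a nonzero multiple of a
  non-integrable function is again non-integrable, so both sides then take the default value
  0.\<close>

lemma T_op_tensor:
  "T_op k a b c (\<lambda>(u, \<eta>). \<phi> u * \<psi> \<eta>) =
    (\<lambda>(z, w). S_op k (a $ 1) (b $ 1) (c $ 1) \<phi> z * S_op k (a $ 2) (b $ 2) (c $ 2) \<psi> w)"
proof (intro ext, clarify)
  fix z w
  have eq: "T_integrand k b c (\<lambda>(u, \<eta>). \<phi> u * \<psi> \<eta>) z w u \<eta> =
     (complex_of_real (gform k (Im_vec u) powr (b $ 1)) / Qpow k (c $ 1) (z - cnj_vec u) * \<phi> u) *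
     (complex_of_real (gform k (Im_vec \<eta>) powr (b $ 2)) / Qpow k (c $ 2) (w - cnj_vec \<eta>) * \<psi> \<eta>)" for u \<eta>
    by (simp add: T_integrand_def)
  show "T_op k a b c (\<lambda>(u, \<eta>). \<phi> u * \<psi> \<eta>) (z, w) =
      S_op k (a $ 1) (b $ 1) (c $ 1) \<phi> z * S_op k (a $ 2) (b $ 2) (c $ 2) \<psi> w"
    unfolding T_op_def S_op_def split eq integral_mult_left_zero integral_mult_right_zero of_real_mult
    by (simp only: mult_ac)
qed

lemma S_op_measurable [measurable]:
  assumes [measurable]: "\<phi> \<in> borel_measurable (vol k)"
  shows "S_op k a b c \<phi> \<in> borel_measurable (vol k)"
proof -
  interpret sigma_finite_measure "vol k" by (rule sigma_finite_vol)
  have Q: "(\<lambda>x. Qpow k c (fst x - cnj_vec (snd x))) \<in> borel_measurable (vol k \<Otimes>\<^sub>M vol k)"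
    using Qpow_kernel_measurable[of k c] by (simp add: case_prod_beta')
  have "(\<lambda>(z, u). complex_of_real (gform k (Im_vec u) powr b) / Qpow k c (z - cnj_vec u) * \<phi> u)
      \<in> borel_measurable (vol k \<Otimes>\<^sub>M vol k)"
    unfolding case_prod_beta' by (intro borel_measurable_times borel_measurable_divide Q) simp_all
  from borel_measurable_lebesgue_integral[OF this] show ?thesis
    unfolding S_op_def by simp
qed

text \<open>Substituting r z produces r^(2n) from the volume and r^(2 \<alpha>) from the weight, as
  g has degree 2; the outer root divides the exponent by p.\<close>

lemma lnorm_scaleR:
  fixes k :: "'n::finite"
  assumes [measurable]: "\<phi> \<in> borel_measurable (vol k)" and "r > 0" "p > 0"
  shows "lnorm k p \<alpha> (\<lambda>z. \<phi> (inverse r *\<^sub>R z)) =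
    ennreal (r powr ((2 * real CARD('n) + 2 * \<alpha>) / p)) * lnorm k p \<alpha> \<phi>"
proof -
  have [measurable]: "(\<lambda>z. \<phi> (inverse r *\<^sub>R z)) \<in> borel_measurable (vol k)"
    using assms by (intro measurable_compose[OF scaleR_measurable_vol]) auto
  have "(\<integral>\<^sup>+z. ennreal (norm (\<phi> (inverse r *\<^sub>R z)) powr p) \<partial>wvol k \<alpha>) =
      ennreal (r ^ (2 * CARD('n))) * (\<integral>\<^sup>+z. ennreal (gform k (Im_vec (r *\<^sub>R z)) powr \<alpha>) * ennreal (norm (\<phi> z) powr p) \<partial>vol k)"
    using \<open>r > 0\<close> by (subst nn_integral_wvol, simp, subst nn_integral_vol_scaleR[OF \<open>r > 0\<close>]) auto
  also have "(\<integral>\<^sup>+z. ennreal (gform k (Im_vec (r *\<^sub>R z)) powr \<alpha>) * ennreal (norm (\<phi> z) powr p) \<partial>vol k) =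
      (\<integral>\<^sup>+z. ennreal (r powr (2 * \<alpha>)) * (ennreal (gform k (Im_vec z) powr \<alpha>) * ennreal (norm (\<phi> z) powr p)) \<partial>vol k)"
    using assms by (intro nn_integral_cong) (simp add: gform_scaleR_powr ennreal_mult mult.assoc)
  also have "\<dots> = ennreal (r powr (2 * \<alpha>)) * (\<integral>\<^sup>+z. ennreal (norm (\<phi> z) powr p) \<partial>wvol k \<alpha>)"
    by (subst nn_integral_cmult) (simp_all add: nn_integral_wvol)
  also have "ennreal (r ^ (2 * CARD('n))) * (ennreal (r powr (2 * \<alpha>)) * (\<integral>\<^sup>+z. ennreal (norm (\<phi> z) powr p) \<partial>wvol k \<alpha>)) =
      ennreal (r powr (2 * real CARD('n) + 2 * \<alpha>)) * (\<integral>\<^sup>+z. ennreal (norm (\<phi> z) powr p) \<partial>wvol k \<alpha>)"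
    using \<open>r > 0\<close> by (simp add: powr_add mult.assoc[symmetric] flip: ennreal_mult powr_realpow)
  finally show ?thesis
    using \<open>p > 0\<close> by (simp add: lnorm_def ennreal_powr_mult ennreal_powr_ennreal powr_powr)
qed

text \<open>The substitution u = r u' collects r^(2n) from the volume, r^(2a) and r^(2b) from the
  two weights, and r^(-2c) from the kernel.\<close>

lemma S_op_scaleR:
  fixes k :: "'n::finite"
  assumes [measurable]: "\<phi> \<in> borel_measurable (vol k)" and "r > 0" and z: "z \<in> tube k"
  shows "S_op k a b c (\<lambda>u. \<phi> (inverse r *\<^sub>R u)) (r *\<^sub>R z) =
    complex_of_real (r powr (2 * real CARD('n) + 2 * a + 2 * b - 2 * c)) * S_op k a b c \<phi> z"
proof -
  let ?h = "\<lambda>u. complex_of_real (gform k (Im_vec u) powr b) / Qpow k c (r *\<^sub>R z - cnj_vec u) * \<phi> (inverse r *\<^sub>R u)"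
  have rz: "r *\<^sub>R z \<in> tube k" using assms by (simp add: tube_scaleR)
  have [measurable]: "(\<lambda>z. \<phi> (inverse r *\<^sub>R z)) \<in> borel_measurable (vol k)"
    using assms by (intro measurable_compose[OF scaleR_measurable_vol]) auto
  have Q: "(\<lambda>u. Qpow k c (r *\<^sub>R z - cnj_vec u)) \<in> borel_measurable (vol k)"
    using measurable_compose[OF measurable_Pair1'[of "r *\<^sub>R z" "vol k" "vol k"] Qpow_kernel_measurable[of k c]] rz by simp
  have "?h \<in> borel_measurable (vol k)"
    by (intro borel_measurable_times borel_measurable_divide Q) simp_all
  then have "(LINT u|vol k. ?h u) = of_real (r ^ (2 * CARD('n))) * (LINT u|vol k. ?h (r *\<^sub>R u))"
    by (rule integral_vol_scaleR[OF \<open>r > 0\<close>])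
  also have "(LINT u|vol k. ?h (r *\<^sub>R u)) = (LINT u|vol k. complex_of_real (r powr (2 * b - 2 * c)) *
      (complex_of_real (gform k (Im_vec u) powr b) / Qpow k c (z - cnj_vec u) * \<phi> u))"
  proof (intro Bochner_Integration.integral_cong refl)
    fix u assume "u \<in> space (vol k)"
    then have u: "u \<in> tube k" by simp
    have "r *\<^sub>R z - cnj_vec (r *\<^sub>R u) = r *\<^sub>R (z - cnj_vec u)"
      by (simp add: cnj_vec_scaleR scaleR_diff_right)
    then show "?h (r *\<^sub>R u) = complex_of_real (r powr (2 * b - 2 * c)) *
      (complex_of_real (gform k (Im_vec u) powr b) / Qpow k c (z - cnj_vec u) * \<phi> u)"
      using u z \<open>r > 0\<close>
      by (simp add: gform_scaleR_powr Qpow_scaleR diff_cnj_in_tube powr_diff)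
  qed
  finally have int: "(LINT u|vol k. ?h u) = complex_of_real (r ^ (2 * CARD('n))) *
      (complex_of_real (r powr (2 * b - 2 * c)) *
       (LINT u|vol k. complex_of_real (gform k (Im_vec u) powr b) / Qpow k c (z - cnj_vec u) * \<phi> u))"
    unfolding integral_mult_right_zero .
  have e: "r powr (2 * real CARD('n) + 2 * a + 2 * b - 2 * c) =
      r powr (2 * a) * (r ^ (2 * CARD('n)) * r powr (2 * b - 2 * c))"
    using \<open>r > 0\<close> by (simp add: algebra_simps flip: powr_realpow powr_add)
  show ?thesis
    unfolding S_op_def int e gform_scaleR_powr[OF \<open>r > 0\<close> z] of_real_mult by (simp only: mult_ac)
qed

section \<open>The kernel near the base point\<close>

lemma norm_cnj_vec: "norm (cnj_vec z) = norm z"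
  by (simp add: norm_vec_def cnj_vec_def)

lemma cnj_vec_diff: "cnj_vec (z - w) = cnj_vec z - cnj_vec w"
  by (simp add: cnj_vec_def vec_eq_iff)

abbreviation base_pt :: "'n::finite \<Rightarrow> complex^'n" where
  "base_pt k \<equiv> ii_vec (axis k 1)"

lemma cnj_vec_base_pt: "cnj_vec (base_pt k) = - base_pt k"
  by (simp add: cnj_vec_def ii_vec_def vec_eq_iff)

lemma base_pt_in_tube: "base_pt k \<in> tube k"
  by (simp add: tube_def axis_in_light_cone)

lemma Qpow_base_pt: "Qpow k c (base_pt k) = 1"
proof -
  have "gform k (axis k 1) = 1"
    by (simp add: gform_def L2_set_def axis_nth_offdiag)
  then show ?thesis
    using Qform_powr_ii_vec[where c = c, OF axis_in_light_cone[of k]] is_Qpow_unique[OF is_Qpow_Qpow base_pt_in_tube, of k c]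
    by simp
qed

text \<open>Conjugation sends the base point to its negative, so z - u* is near the base point
  whichever of z and u is the one near it. The two errors add up to less than 2d.\<close>

lemma diff_cnj_near_base_pt:
  assumes "(z \<in> ball 0 d \<and> u \<in> ball (base_pt k) d) \<or> (z \<in> ball (base_pt k) d \<and> u \<in> ball 0 d)"
  shows "z - cnj_vec u \<in> ball (base_pt k) (2 * d)"
proof -
  from assms show ?thesis
  proof
    assume *: "z \<in> ball 0 d \<and> u \<in> ball (base_pt k) d"
    have "dist (base_pt k) (z - cnj_vec u) = norm (cnj_vec (u - base_pt k) - z)"
      by (simp add: dist_norm cnj_vec_diff cnj_vec_base_pt algebra_simps)
    also have "\<dots> \<le> norm (u - base_pt k) + norm z"
      using norm_triangle_ineq4[of "cnj_vec (u - base_pt k)" z] by (simp add: norm_cnj_vec)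
    finally show ?thesis using * by (simp add: dist_norm norm_minus_commute)
  next
    assume *: "z \<in> ball (base_pt k) d \<and> u \<in> ball 0 d"
    have "dist (base_pt k) (z - cnj_vec u) = norm ((base_pt k - z) + cnj_vec u)"
      by (simp add: dist_norm algebra_simps)
    also have "\<dots> \<le> norm (base_pt k - z) + norm u"
      using norm_triangle_ineq[of "base_pt k - z" "cnj_vec u"] by (simp add: norm_cnj_vec)
    finally show ?thesis using * by (simp add: dist_norm)
  qed
qed

text \<open>1/Q^c is continuous on the tube with value 1 at the base point. The bound on the real
  part excludes cancellation, the bound on the modulus gives integrability. The kernel is controlled
  on the doubled ball because its argument is a difference of points from two balls of radius
  \<open>d\<close>.\<close>

lemma Qpow_near_base_pt:
  obtains d where "d > 0" "cball (base_pt k) d \<subseteq> tube k"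
    "\<And>\<zeta>. \<zeta> \<in> ball (base_pt k) (2 * d) \<Longrightarrow> Re (1 / Qpow k c \<zeta>) \<ge> 1 / 2 \<and> norm (1 / Qpow k c \<zeta>) \<le> 2"
proof -
  have "continuous_on (tube k) (\<lambda>\<zeta>. 1 / Qpow k c \<zeta>)"
    by (intro continuous_intros continuous_on_Qpow) (simp add: Qpow_nonzero)
  then have "isCont (\<lambda>\<zeta>. 1 / Qpow k c \<zeta>) (base_pt k)"
    using continuous_on_eq_continuous_at open_tube base_pt_in_tube by blast
  then obtain s where s: "s > 0" "\<And>\<zeta>. dist \<zeta> (base_pt k) < s \<Longrightarrow> dist (1 / Qpow k c \<zeta>) 1 < 1 / 2"
    unfolding continuous_at_eps_delta Qpow_base_pt by (metis div_by_1 half_gt_zero_iff zero_less_one)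
  obtain t where t: "t > 0" "cball (base_pt k) t \<subseteq> tube k"
    using open_contains_cball open_tube base_pt_in_tube by blast
  show ?thesis
  proof (rule that[of "min s t / 2"])
    fix \<zeta> assume "\<zeta> \<in> ball (base_pt k) (2 * (min s t / 2))"
    then have *: "norm (1 / Qpow k c \<zeta> - 1) < 1 / 2"
      using s(2)[of \<zeta>] by (simp only: dist_norm[symmetric]) (simp add: dist_commute)
    moreover have "\<bar>Re (1 / Qpow k c \<zeta> - 1)\<bar> \<le> norm (1 / Qpow k c \<zeta> - 1)" by (rule abs_Re_le_cmod)
    moreover have "norm (1 / Qpow k c \<zeta>) \<le> norm (1 / Qpow k c \<zeta> - 1) + norm (1::complex)"
      using norm_triangle_ineq[of "1 / Qpow k c \<zeta> - 1" 1] by simp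
    ultimately show "Re (1 / Qpow k c \<zeta>) \<ge> 1 / 2 \<and> norm (1 / Qpow k c \<zeta>) \<le> 2"
      by (simp only: minus_complex.sel one_complex.sel norm_one abs_le_iff) (intro conjI; linarith)
  next
    show "cball (base_pt k) (min s t / 2) \<subseteq> tube k"
      using s t by (intro order_trans[OF subset_cball t(2)]) auto
  qed (use s t in auto)
qed

section \<open>Lower bounds for the operator, and integrals of the weight over balls\<close>

text \<open>For \<phi> \<ge> 0 the real part of the integrand is at least half of g^b \<phi>. The
  modulus bound makes the integrand integrable, so the real part passes through the
  integral.\<close>

lemma norm_S_op_ge:
  fixes \<phi> :: "complex^'n::finite \<Rightarrow> real"
  assumes [measurable]: "\<phi> \<in> borel_measurable (vol k)" and nonneg: "\<And>u. \<phi> u \<ge> 0"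
    and int: "integrable (vol k) (\<lambda>u. gform k (Im_vec u) powr b * \<phi> u)"
    and z: "z \<in> tube k"
    and Q: "\<And>u. u \<in> tube k \<Longrightarrow> \<phi> u \<noteq> 0 \<Longrightarrow>
      Re (1 / Qpow k c (z - cnj_vec u)) \<ge> 1 / 2 \<and> norm (1 / Qpow k c (z - cnj_vec u)) \<le> 2"
  shows "norm (S_op k a b c (\<lambda>u. complex_of_real (\<phi> u)) z) \<ge>
    gform k (Im_vec z) powr a * ((LINT u|vol k. gform k (Im_vec u) powr b * \<phi> u) / 2)"
proof -
  let ?h = "\<lambda>u. gform k (Im_vec u) powr b * \<phi> u"
  let ?F = "\<lambda>u. complex_of_real (gform k (Im_vec u) powr b) / Qpow k c (z - cnj_vec u) * complex_of_real (\<phi> u)"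
  have F: "?F u = complex_of_real (?h u) * (1 / Qpow k c (z - cnj_vec u))" for u
    by simp
  have Qm: "(\<lambda>u. Qpow k c (z - cnj_vec u)) \<in> borel_measurable (vol k)"
    using measurable_compose[OF measurable_Pair1'[of z "vol k" "vol k"] Qpow_kernel_measurable[of k c]] z by simp
  have Fm: "?F \<in> borel_measurable (vol k)"
    by (intro borel_measurable_times borel_measurable_divide Qm) simp_all
  have bound: "?h u / 2 \<le> Re (?F u) \<and> norm (?F u) \<le> 2 * ?h u" if "u \<in> tube k" for u
  proof (cases "\<phi> u = 0")
    case False
    have h: "?h u \<ge> 0" using nonneg by simp
    have "Re (?F u) = ?h u * Re (1 / Qpow k c (z - cnj_vec u))"
      unfolding F by (simp only: Re_complex_of_real Im_complex_of_real times_complex.sel)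
    moreover have "norm (?F u) = ?h u * norm (1 / Qpow k c (z - cnj_vec u))"
      unfolding F norm_mult[of "complex_of_real _"] norm_of_real using h by simp
    moreover have "?h u * (1 / 2) \<le> ?h u * Re (1 / Qpow k c (z - cnj_vec u))"
       "?h u * norm (1 / Qpow k c (z - cnj_vec u)) \<le> ?h u * 2"
      using Q[OF that False] h by (intro mult_left_mono; blast)+
    ultimately show ?thesis by simp
  qed simp
  have intF: "integrable (vol k) ?F"
    using int by (intro Bochner_Integration.integrable_bound[OF _ Fm, of "\<lambda>u. 2 * ?h u"] AE_I2)
      (use bound nonneg in \<open>simp_all add: abs_mult\<close>)
  have "(LINT u|vol k. ?h u) / 2 = (LINT u|vol k. ?h u / 2)" by simp
  also have "\<dots> \<le> (LINT u|vol k. Re (?F u))"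
    using int intF bound by (intro integral_mono integrable_Re) auto
  also have "\<dots> = Re (LINT u|vol k. ?F u)" using intF by (rule integral_Re)
  also have "\<dots> \<le> norm (LINT u|vol k. ?F u)" by (rule complex_Re_le_cmod)
  finally show ?thesis
    unfolding S_op_def norm_mult norm_of_real abs_of_nonneg[OF powr_ge_zero]
    by (rule mult_left_mono[OF _ powr_ge_zero])
qed

text \<open>Source of the exponent a q + \<beta>: the lower bound g^a A is raised to the power q and
  meets the weight g^\<beta>.\<close>

lemma lnorm_ge:
  assumes [measurable]: "\<phi> \<in> borel_measurable (vol k)" "D \<in> sets borel" and "A \<ge> 0" "q > 0"
    and ge: "\<And>z. z \<in> tube k \<Longrightarrow> z \<in> D \<Longrightarrow> norm (\<phi> z) \<ge> gform k (Im_vec z) powr a * A"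
  shows "lnorm k q \<beta> \<phi> \<ge>
    ennreal A * ennreal_powr (\<integral>\<^sup>+z. indicator D z * ennreal (gform k (Im_vec z) powr (a * q + \<beta>)) \<partial>vol k) (1 / q)"
proof -
  have [measurable]: "(indicator D :: _ \<Rightarrow> ennreal) \<in> borel_measurable (vol k)"
    by (intro borel_measurable_vol) simp
  have "ennreal (A powr q) * (\<integral>\<^sup>+z. indicator D z * ennreal (gform k (Im_vec z) powr (a * q + \<beta>)) \<partial>vol k) =
      (\<integral>\<^sup>+z. ennreal (A powr q) * (indicator D z * ennreal (gform k (Im_vec z) powr (a * q + \<beta>))) \<partial>vol k)"
    by (subst nn_integral_cmult) simp_all
  also have "\<dots> \<le> (\<integral>\<^sup>+z. ennreal (gform k (Im_vec z) powr \<beta>) * ennreal (norm (\<phi> z) powr q) \<partial>vol k)"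
  proof (intro nn_integral_mono)
    fix z assume "z \<in> space (vol k)"
    then have z: "z \<in> tube k" by simp
    show "ennreal (A powr q) * (indicator D z * ennreal (gform k (Im_vec z) powr (a * q + \<beta>))) \<le>
        ennreal (gform k (Im_vec z) powr \<beta>) * ennreal (norm (\<phi> z) powr q)"
    proof (cases "z \<in> D")
      case True
      have "(gform k (Im_vec z) powr a * A) powr q \<le> norm (\<phi> z) powr q"
        using ge[OF z True] \<open>A \<ge> 0\<close> \<open>q > 0\<close> by (intro powr_mono2) auto
      then have "gform k (Im_vec z) powr \<beta> * (gform k (Im_vec z) powr a * A) powr q
          \<le> gform k (Im_vec z) powr \<beta> * norm (\<phi> z) powr q"
        by (intro mult_left_mono) auto
      then have "A powr q * gform k (Im_vec z) powr (a * q + \<beta>) \<le> gform k (Im_vec z) powr \<beta> * norm (\<phi> z) powr q"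
        using gform_Im_vec_pos[OF z] \<open>A \<ge> 0\<close> by (simp add: powr_mult powr_powr powr_add algebra_simps)
      then show ?thesis using True by (simp add: ennreal_leI flip: ennreal_mult)
    qed simp
  qed
  also have "\<dots> = (\<integral>\<^sup>+z. ennreal (norm (\<phi> z) powr q) \<partial>wvol k \<beta>)"
    by (subst nn_integral_wvol) simp_all
  finally have "ennreal_powr (ennreal (A powr q) * (\<integral>\<^sup>+z. indicator D z * ennreal (gform k (Im_vec z) powr (a * q + \<beta>)) \<partial>vol k)) (1 / q)
      \<le> lnorm k q \<beta> \<phi>"
    unfolding lnorm_def using \<open>q > 0\<close> by (intro ennreal_powr_mono) auto
  then show ?thesis
    using \<open>q > 0\<close> \<open>A \<ge> 0\<close> by (simp add: ennreal_powr_mult ennreal_powr_ennreal powr_powr)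
qed

lemma nn_integral_gform_powr_pos:
  assumes "open D" "D \<inter> tube k \<noteq> {}"
  shows "(\<integral>\<^sup>+z. indicator D z * ennreal (gform k (Im_vec z) powr s) \<partial>vol k) > 0"
proof (rule ccontr)
  have [measurable]: "(indicator D :: _ \<Rightarrow> ennreal) \<in> borel_measurable (vol k)"
    using assms by (intro borel_measurable_vol) simp
  assume "\<not> ?thesis"
  then have "AE z in vol k. indicator D z * ennreal (gform k (Im_vec z) powr s) = 0"
    by (subst nn_integral_0_iff_AE[symmetric]) simp_all
  then have "AE z in vol k. z \<notin> D \<inter> tube k"
    by (rule AE_mp) (use gform_Im_vec_pos in \<open>fastforce intro!: AE_I2 simp: indicator_def\<close>)
  then have "AE z in lborel. z \<notin> D \<inter> tube k"
    unfolding vol_def by (subst (asm) AE_restrict_space_iff) auto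
  then have "emeasure lborel (D \<inter> tube k) = 0"
    using assms open_tube[of k] by (subst (asm) AE_iff_measurable[of "D \<inter> tube k"]) auto
  then show False
    using emeasure_lborel_open_pos[of "D \<inter> tube k"] assms open_tube[of k] by (simp add: open_Int)
qed

text \<open>g is positive and continuous on a compact ball inside the tube, so each of its powers,
  negative ones included, is bounded there.\<close>

lemma nn_integral_gform_powr_finite:
  assumes "cball x d \<subseteq> tube k"
  shows "(\<integral>\<^sup>+z. indicator (ball x d) z * ennreal (gform k (Im_vec z) powr s) \<partial>vol k) < \<infinity>"
proof -
  have "continuous_on (cball x d) (\<lambda>z. gform k (Im_vec z) powr s)"
    using assms gform_Im_vec_pos[of _ k]
    by (intro continuous_on_powr continuous_on_gform_Im_vec continuous_on_const) force
  then have "bounded ((\<lambda>z. gform k (Im_vec z) powr s) ` cball x d)"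
    by (intro compact_imp_bounded compact_continuous_image) auto
  then obtain M where M: "\<And>z. z \<in> cball x d \<Longrightarrow> gform k (Im_vec z) powr s \<le> M"
    unfolding bounded_iff by (metis abs_le_D1 image_eqI real_norm_def)
  have "(\<integral>\<^sup>+z. indicator (ball x d) z * ennreal (gform k (Im_vec z) powr s) \<partial>vol k)
      \<le> (\<integral>\<^sup>+z. ennreal M * indicator (ball x d) z \<partial>lborel)"
    unfolding nn_integral_vol
    by (intro nn_integral_mono) (use M in \<open>auto simp: indicator_def intro!: ennreal_leI\<close>)
  also have "\<dots> < \<infinity>"
    using emeasure_lborel_ball_finite[of x d] by (simp add: nn_integral_cmult_indicator ennreal_mult_less_top)
  finally show ?thesis .
qed

subsection \<open>Necessary conditions for boundedness\<close>

lemma nn_integral_indicator_gform_eq_integral: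
  assumes "A \<in> sets borel"
    and fin: "(\<integral>\<^sup>+z. indicator A z * ennreal (gform k (Im_vec z) powr s) \<partial>vol k) < \<infinity>"
  shows "integrable (vol k) (\<lambda>z. indicator A z * gform k (Im_vec z) powr s)"
    and "(\<integral>\<^sup>+z. indicator A z * ennreal (gform k (Im_vec z) powr s) \<partial>vol k) =
      ennreal (LINT z|vol k. indicator A z * gform k (Im_vec z) powr s)"
proof -
  have [measurable]: "(indicator A :: _ \<Rightarrow> real) \<in> borel_measurable (vol k)"
    using assms by (intro indicator_vol_measurable)
  have eq: "indicator A z * ennreal (gform k (Im_vec z) powr s) =
      ennreal (indicator A z * gform k (Im_vec z) powr s)" for z
    by (simp add: indicator_def)
  show int: "integrable (vol k) (\<lambda>z. indicator A z * gform k (Im_vec z) powr s)"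
    using fin unfolding eq by (intro integrableI_nonneg) simp_all
  show "(\<integral>\<^sup>+z. indicator A z * ennreal (gform k (Im_vec z) powr s) \<partial>vol k) =
      ennreal (LINT z|vol k. indicator A z * gform k (Im_vec z) powr s)"
    unfolding eq by (rule nn_integral_eq_integral[OF int]) simp
qed

lemma lnorm_indicator_gform:
  assumes A: "A \<in> sets borel" and "p > 0"
  shows "lnorm k p \<alpha> (\<lambda>z. complex_of_real (indicator A z * gform k (Im_vec z) powr s)) =
    ennreal_powr (\<integral>\<^sup>+z. indicator A z * ennreal (gform k (Im_vec z) powr (s * p + \<alpha>)) \<partial>vol k) (1 / p)"
proof -
  have [measurable]: "(indicator A :: _ \<Rightarrow> real) \<in> borel_measurable (vol k)"
    using assms by (intro indicator_vol_measurable)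
  have "(\<integral>\<^sup>+z. ennreal (norm (complex_of_real (indicator A z * gform k (Im_vec z) powr s)) powr p) \<partial>wvol k \<alpha>)
      = (\<integral>\<^sup>+z. indicator A z * ennreal (gform k (Im_vec z) powr (s * p + \<alpha>)) \<partial>vol k)"
  proof (subst nn_integral_wvol, simp, rule nn_integral_cong)
    fix z assume "z \<in> space (vol k)"
    then have "gform k (Im_vec z) > 0" by (simp add: gform_Im_vec_pos)
    then show "ennreal (gform k (Im_vec z) powr \<alpha>) *
        ennreal (norm (complex_of_real (indicator A z * gform k (Im_vec z) powr s)) powr p) =
        indicator A z * ennreal (gform k (Im_vec z) powr (s * p + \<alpha>))"
      using \<open>p > 0\<close> by (cases "z \<in> A") (simp_all add: powr_powr powr_add mult.commute flip: ennreal_mult)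
  qed
  then show ?thesis by (simp add: lnorm_def)
qed

text \<open>Common estimate for both tests. With \<open>A\<close> near the base point and
  \<open>D\<close> near 0 it yields the condition on a; with the roles exchanged, the condition on
  b. The factor 1/2 is the lower bound on the real part of the kernel.\<close>

lemma lnorm_S_op_indicator_ge:
  fixes k :: "'n::finite" and b s :: real
  assumes A: "A \<in> sets borel" and D: "D \<in> sets borel" and "q > 0"
    and fin: "(\<integral>\<^sup>+z. indicator A z * ennreal (gform k (Im_vec z) powr (b + s)) \<partial>vol k) < \<infinity>"
    and Q: "\<And>z u. z \<in> D \<Longrightarrow> u \<in> A \<Longrightarrow>
      Re (1 / Qpow k c (z - cnj_vec u)) \<ge> 1 / 2 \<and> norm (1 / Qpow k c (z - cnj_vec u)) \<le> 2"
  shows "ennreal (1 / 2) * (\<integral>\<^sup>+z. indicator A z * ennreal (gform k (Im_vec z) powr (b + s)) \<partial>vol k) *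
      ennreal_powr (\<integral>\<^sup>+z. indicator D z * ennreal (gform k (Im_vec z) powr (a * q + \<beta>)) \<partial>vol k) (1 / q)
    \<le> lnorm k q \<beta> (S_op k a b c (\<lambda>z. complex_of_real (indicator A z * gform k (Im_vec z) powr s)))"
proof -
  have [measurable]: "(indicator A :: _ \<Rightarrow> real) \<in> borel_measurable (vol k)"
    using assms by (intro indicator_vol_measurable)
  let ?I = "LINT z|vol k. indicator A z * gform k (Im_vec z) powr (b + s)"
  have eq: "gform k (Im_vec z) powr b * (indicator A z * gform k (Im_vec z) powr s) =
      indicator A z * gform k (Im_vec z) powr (b + s)" for z
    by (simp add: powr_add)
  note I = nn_integral_indicator_gform_eq_integral[OF A fin]
  have I0: "?I \<ge> 0" by (rule Bochner_Integration.integral_nonneg) simp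
  have "lnorm k q \<beta> (S_op k a b c (\<lambda>z. complex_of_real (indicator A z * gform k (Im_vec z) powr s))) \<ge>
     ennreal (?I / 2) *
      ennreal_powr (\<integral>\<^sup>+z. indicator D z * ennreal (gform k (Im_vec z) powr (a * q + \<beta>)) \<partial>vol k) (1 / q)"
  proof (rule lnorm_ge)
    fix z assume "z \<in> tube k" "z \<in> D"
    then show "gform k (Im_vec z) powr a * (?I / 2)
        \<le> norm (S_op k a b c (\<lambda>z. complex_of_real (indicator A z * gform k (Im_vec z) powr s)) z)"
      using norm_S_op_ge[of "\<lambda>z. indicator A z * gform k (Im_vec z) powr s" k b z c a] I(1) Q
      unfolding eq by (auto simp: indicator_eq_0_iff)
  qed (use assms I0 in simp_all)
  moreover have "ennreal (?I / 2) = ennreal (1 / 2) * ennreal ?I"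
    using I0 by (subst ennreal_mult[symmetric]) auto
  ultimately show ?thesis unfolding I(2) by (simp only:)
qed

text \<open>Strict positivity of the image norm is needed twice later: to divide out the other
  factor of a tensor product, and to compare powers of the dilation factor.\<close>

lemma S_op_test_function:
  fixes k :: "'n::finite"
  assumes "p > 0" "q > 0"
  obtains \<phi> where "\<phi> \<in> borel_measurable (vol k)" "lnorm k p \<alpha> \<phi> < \<infinity>"
    "lnorm k q \<beta> (S_op k a b c \<phi>) > 0"
    "lnorm k q \<beta> (S_op k a b c \<phi>) < \<infinity> \<Longrightarrow> a * q + \<beta> > - 1"
proof -
  obtain d where d: "d > 0" "cball (base_pt k) d \<subseteq> tube k"
    and Q: "\<And>\<zeta>. \<zeta> \<in> ball (base_pt k) (2 * d) \<Longrightarrow> Re (1 / Qpow k c \<zeta>) \<ge> 1 / 2 \<and> norm (1 / Qpow k c \<zeta>) \<le> 2"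
    using Qpow_near_base_pt[of k c] by metis
  let ?B = "ball (base_pt k) d" and ?K = "ball (0 :: complex^'n) d"
  note finB = nn_integral_gform_powr_finite[OF d(2)]
  \<comment> \<open>\<open>powr 0\<close> equals 1 on the ball, where g is positive; writing it
    brings the indicator into the shape that the lemmas on truncated powers of g expect.\<close>
  let ?\<phi> = "\<lambda>z. complex_of_real (indicator ?B z * gform k (Im_vec z) powr 0)"
  let ?X = "\<integral>\<^sup>+z. indicator ?B z * ennreal (gform k (Im_vec z) powr (b + 0)) \<partial>vol k"
  let ?Y = "\<integral>\<^sup>+z. indicator ?K z * ennreal (gform k (Im_vec z) powr (a * q + \<beta>)) \<partial>vol k"
  have [measurable]: "(indicator ?B :: _ \<Rightarrow> real) \<in> borel_measurable (vol k)"
    by (intro indicator_vol_measurable) simp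
  have X: "?X > 0"
    using base_pt_in_tube[of k] d(1) centre_in_ball by (intro nn_integral_gform_powr_pos) blast+
  have Y: "?Y > 0"
  proof (intro nn_integral_gform_powr_pos)
    \<comment> \<open>The base point shrunk to norm d/2; the tube is invariant under
      dilation.\<close>
    have "(d / (2 * norm (base_pt k))) *\<^sub>R base_pt k \<in> ?K \<inter> tube k"
    proof -
      have "base_pt k \<noteq> 0" by (simp add: ii_vec_def vec_eq_iff axis_def)
      then show ?thesis using d base_pt_in_tube[of k] by (simp add: tube_scaleR)
    qed
    then show "?K \<inter> tube k \<noteq> {}" by blast
  qed simp
  have le: "ennreal (1 / 2) * ?X * ennreal_powr ?Y (1 / q) \<le> lnorm k q \<beta> (S_op k a b c ?\<phi>)"
    using \<open>q > 0\<close> finB by (intro lnorm_S_op_indicator_ge Q diff_cnj_near_base_pt) auto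
  have X2: "ennreal (1 / 2) * ?X > 0"
    using X unfolding ennreal_zero_less_mult_iff ennreal_less_zero_iff by simp
  show ?thesis
  proof (rule that[of ?\<phi>])
    show "?\<phi> \<in> borel_measurable (vol k)" by simp
    show "lnorm k p \<alpha> ?\<phi> < \<infinity>"
      using finB[of "0 * p + \<alpha>"] lnorm_indicator_gform[of ?B p k \<alpha> 0] \<open>p > 0\<close>
      by (simp add: ennreal_powr_eq_top_iff less_top[symmetric])
    show "lnorm k q \<beta> (S_op k a b c ?\<phi>) > 0"
    proof (rule less_le_trans[OF _ le])
      show "0 < ennreal (1 / 2) * ?X * ennreal_powr ?Y (1 / q)"
        using X2 Y ennreal_powr_eq_0_iff[of ?Y "1 / q"]
        by (subst ennreal_zero_less_mult_iff) (auto simp: zero_less_iff_neq_zero)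
    qed
    assume fin: "lnorm k q \<beta> (S_op k a b c ?\<phi>) < \<infinity>"
    show "a * q + \<beta> > - 1"
    proof (rule ccontr)
      assume "\<not> ?thesis"
      then have "?Y = \<infinity>" using d by (intro nn_integral_gform_powr_eq_top) auto
      then have "ennreal_powr ?Y (1 / q) = \<infinity>" by (simp add: ennreal_powr_eq_top_iff)
      then show False using le fin X2 by (simp add: ennreal_mult_top zero_less_iff_neq_zero)
    qed
  qed
qed

text \<open>For the truncated power g^s the same integral I occurs on both sides of the bound, as I
  y / 2 \<le> C I^(1/p). Since 1/p < 1, this bounds I uniformly in the truncation, although I tends
  to \<infinity> as the truncation is removed.\<close>

lemma S_op_bounded_imp_weight:
  fixes k :: "'n::finite"
  assumes p: "p > 1" and q: "q > 0" and C: "C \<ge> 0"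
    and bounded: "\<And>\<phi>. \<phi> \<in> borel_measurable (vol k) \<Longrightarrow> lnorm k p \<alpha> \<phi> < \<infinity> \<Longrightarrow>
      lnorm k q \<beta> (S_op k a b c \<phi>) \<le> ennreal C * lnorm k p \<alpha> \<phi>"
  shows "\<alpha> + 1 < p * (b + 1)"
proof (rule ccontr)
  assume neg: "\<not> ?thesis"
  \<comment> \<open>The power for which the two integrands \<open>g\<^sup>b \<phi>\<close> and \<open>g\<^sup>\<alpha> \<phi>\<^sup>p\<close> with \<open>\<phi> = g\<^sup>s\<close> coincide.\<close>
  define s where "s = (b - \<alpha>) / (p - 1)"
  \<comment> \<open>Here b + s = (b p - \<alpha>)/(p - 1), so the second claim is the negated
    conclusion rearranged.\<close>
  have s: "s * p + \<alpha> = b + s" "b + s \<le> - 1"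
    using p neg by (simp_all add: s_def field_simps)
  obtain d where d: "d > 0" "cball (base_pt k) d \<subseteq> tube k"
    and Q: "\<And>\<zeta>. \<zeta> \<in> ball (base_pt k) (2 * d) \<Longrightarrow> Re (1 / Qpow k c \<zeta>) \<ge> 1 / 2 \<and> norm (1 / Qpow k c \<zeta>) \<le> 2"
    using Qpow_near_base_pt[of k c] by metis
  let ?B = "ball (base_pt k) d"
  \<comment> \<open>Keeping g away from 0 bounds g^(b+s), whose exponent is negative, so that the
    test function has finite norm.\<close>
  define K where "K = (\<lambda>m. ball (0 :: complex^'n) d \<inter> {z. gform k (Im_vec z) \<ge> 1 / real (Suc m)})"
  define I where "I = (\<lambda>m. \<integral>\<^sup>+z. indicator (K m) z * ennreal (gform k (Im_vec z) powr (b + s)) \<partial>vol k)"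
  have [measurable, simp]: "K m \<in> sets borel" for m
    unfolding K_def
    by (rule sets.Int, simp, rule borel_closed, intro closed_Collect_le continuous_on_gform_Im_vec continuous_on_const)
  have [measurable]: "(indicator (K m) :: _ \<Rightarrow> real) \<in> borel_measurable (vol k)" 
     "(indicator (K m) :: _ \<Rightarrow> ennreal) \<in> borel_measurable (vol k)" for m
    by (intro indicator_vol_measurable borel_measurable_vol; simp)+
  have K_ball: "u \<in> ball 0 d" if "u \<in> K m" for u m
    using that by (simp add: K_def)
  have I_fin: "I m < \<infinity>" for m
  proof -
    have "I m \<le> (\<integral>\<^sup>+z. ennreal ((1 / real (Suc m)) powr (b + s)) * indicator (ball (0 :: complex^'n) d) z \<partial>lborel)"
      unfolding I_def nn_integral_vol
    proof (intro nn_integral_mono)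
      fix z :: "complex^'n"
      have "gform k (Im_vec z) powr (b + s) \<le> (1 / real (Suc m)) powr (b + s)" if "z \<in> K m"
        using that s(2) by (intro powr_mono2') (auto simp: K_def)
      then show "indicator (K m) z * ennreal (gform k (Im_vec z) powr (b + s)) * indicator (tube k) z
          \<le> ennreal ((1 / real (Suc m)) powr (b + s)) * indicator (ball 0 d) z"
        by (cases "z \<in> K m") (auto simp: K_def indicator_def intro!: ennreal_leI)
    qed
    also have "\<dots> < \<infinity>"
      using emeasure_lborel_ball_finite[of "0 :: complex^'n" d]
      by (simp add: nn_integral_cmult_indicator ennreal_mult_less_top)
    finally show ?thesis .
  qed
  let ?Y = "\<integral>\<^sup>+z. indicator ?B z * ennreal (gform k (Im_vec z) powr (a * q + \<beta>)) \<partial>vol k"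
  have Y: "0 < ?Y"
    using base_pt_in_tube[of k] d(1) centre_in_ball by (intro nn_integral_gform_powr_pos) blast+
  have Y_fin: "?Y < \<infinity>" by (rule nn_integral_gform_powr_finite[OF d(2)])
  obtain y where y: "y > 0" "ennreal_powr ?Y (1 / q) = ennreal y"
  proof -
    obtain y where "ennreal_powr ?Y (1 / q) = ennreal y" "y \<ge> 0"
      using Y_fin ennreal_powr_eq_top_iff[of ?Y "1 / q"] by (cases "ennreal_powr ?Y (1 / q)") auto
    moreover have "y \<noteq> 0"
      using Y ennreal_powr_eq_0_iff[of ?Y "1 / q"] calculation by auto
    ultimately show ?thesis using that by force
  qed
  \<comment> \<open>From x y \<le> 2 C x^(1/p) follows x^(1 - 1/p) \<le> 2 C / y, and p/(p - 1) is
    the reciprocal of 1 - 1/p.\<close>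
  define M where "M = (2 * C / y) powr (p / (p - 1))"
  have "I m \<le> ennreal M" for m
  proof -
    let ?\<phi> = "\<lambda>z. complex_of_real (indicator (K m) z * gform k (Im_vec z) powr s)"
    obtain x where x: "I m = ennreal x" "x \<ge> 0"
      using I_fin[of m] by (cases "I m") auto
    have norm: "lnorm k p \<alpha> ?\<phi> = ennreal (x powr (1 / p))"
      using p x lnorm_indicator_gform[of "K m" p k \<alpha> s]
      by (simp add: s(1) x(1)[unfolded I_def] ennreal_powr_ennreal)
    have "ennreal (1 / 2) * I m * ennreal_powr ?Y (1 / q) \<le> lnorm k q \<beta> (S_op k a b c ?\<phi>)"
      unfolding I_def using q I_fin[of m]
      by (intro lnorm_S_op_indicator_ge Q diff_cnj_near_base_pt) (use K_ball in \<open>auto simp: I_def\<close>)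
    also have "\<dots> \<le> ennreal C * lnorm k p \<alpha> ?\<phi>"
      using norm by (intro bounded) simp_all
    finally have "ennreal (1 / 2 * x * y) \<le> ennreal (C * x powr (1 / p))"
      unfolding norm x(1) y(2) using x(2) y(1) C by (simp only: ennreal_mult mult_nonneg_nonneg powr_ge_zero less_imp_le)
    then have xy: "x * y \<le> 2 * C * x powr (1 / p)"
      using C x y by (simp add: ennreal_le_iff)
    have "x \<le> M"
    proof (cases "x = 0")
      case False
      then have x0: "x > 0" using x by simp
      have "x powr (1 - 1 / p) * x powr (1 / p) = x"
        using x0 by (simp flip: powr_add)
      then have "(x powr (1 - 1 / p) * y) * x powr (1 / p) \<le> (2 * C) * x powr (1 / p)"
        using xy by (simp add: mult_ac)
      then have "x powr (1 - 1 / p) * y \<le> 2 * C"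
        using x0 by (simp only: mult_le_cancel_right_pos powr_gt_zero)
      then have "x powr (1 - 1 / p) \<le> 2 * C / y"
        using y by (simp add: field_simps)
      then have "(x powr (1 - 1 / p)) powr (p / (p - 1)) \<le> M"
        unfolding M_def using p by (intro powr_mono2) auto
      moreover have "(1 - 1 / p) * (p / (p - 1)) = 1" using p by (simp add: field_simps)
      ultimately show ?thesis by (simp only: powr_powr powr_one[OF x(2)])
    qed (simp add: M_def)
    then show ?thesis using x by (simp add: ennreal_leI)
  qed
  then have "(SUP m. I m) \<le> ennreal M" by (rule SUP_least)
  \<comment> \<open>Monotone convergence: g is positive on the tube, so each point of the ball that
    lies in the tube belongs to \<open>K N\<close> for some \<open>N\<close>.\<close>
  moreover have "(SUP m. I m) = (\<integral>\<^sup>+z. indicator (ball 0 d) z * ennreal (gform k (Im_vec z) powr (b + s)) \<partial>vol k)"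
  proof -
    have inc: "incseq K"
    proof (intro incseq_SucI subsetI)
      fix m z assume "z \<in> K m"
      moreover have "1 / real (Suc (Suc m)) \<le> 1 / real (Suc m)" by (intro divide_left_mono) simp_all
      ultimately show "z \<in> K (Suc m)" by (auto simp: K_def simp del: of_nat_Suc)
    qed
    have "(SUP m. I m) = (\<integral>\<^sup>+z. (SUP m. indicator (K m) z * ennreal (gform k (Im_vec z) powr (b + s))) \<partial>vol k)"
      unfolding I_def
    proof (rule nn_integral_monotone_convergence_SUP[symmetric])
      show "incseq (\<lambda>m z. indicator (K m) z * ennreal (gform k (Im_vec z) powr (b + s)))"
        using inc by (auto simp: incseq_def le_fun_def indicator_def)
    qed simp
    also have "\<dots> = (\<integral>\<^sup>+z. indicator (ball 0 d) z * ennreal (gform k (Im_vec z) powr (b + s)) \<partial>vol k)"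
    proof (intro nn_integral_cong)
      fix z assume "z \<in> space (vol k)"
      then have "gform k (Im_vec z) > 0" by (simp add: gform_Im_vec_pos)
      then obtain N where "inverse (real (Suc N)) < gform k (Im_vec z)"
        using reals_Archimedean by blast
      then have N: "z \<in> K N \<longleftrightarrow> z \<in> ball 0 d" by (auto simp: K_def inverse_eq_divide)
      show "(SUP m. indicator (K m) z * ennreal (gform k (Im_vec z) powr (b + s))) =
          indicator (ball 0 d) z * ennreal (gform k (Im_vec z) powr (b + s))"
      proof (intro antisym SUP_least)
        show "indicator (ball 0 d) z * ennreal (gform k (Im_vec z) powr (b + s)) \<le>
            (SUP m. indicator (K m) z * ennreal (gform k (Im_vec z) powr (b + s)))"
          by (rule SUP_upper2[of N]) (use N in \<open>auto simp: indicator_def\<close>)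
      qed (auto simp: indicator_def K_def)
    qed
    finally show ?thesis .
  qed
  ultimately show False
    using nn_integral_gform_powr_eq_top[OF d(1) s(2), of k] by (simp add: top_unique)
qed

section \<open>Dilation and the formula for c\<close>

lemma powr_le_imp_exponent_eq:
  fixes s t C :: real
  assumes "\<And>r. r > 0 \<Longrightarrow> r powr s \<le> C * r powr t"
  shows "s = t"
proof (rule ccontr)
  assume "s \<noteq> t"
  have C: "C > 0" using assms[of 1] by simp
  \<comment> \<open>Chosen so that r^(s - t) = C + 1 exceeds C; the formula covers both signs of s -
    t.\<close>
  define r where "r = (C + 1) powr (1 / (s - t))"
  have "r > 0" using C by (simp add: r_def)
  then have "r powr (s - t) \<le> C"
    using assms[of r] by (simp add: powr_diff field_simps)
  moreover have "r powr (s - t) = C + 1"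
    using C \<open>s \<noteq> t\<close> by (simp add: r_def powr_powr)
  ultimately show False by simp
qed

text \<open>One test function gives both conclusions: finiteness of its image norm gives the first,
  and its dilates give the second.\<close>

lemma S_op_bounded_imp_exponent:
  fixes k :: "'n::finite"
  assumes p: "p > 0" and q: "q > 0" and C: "C \<ge> 0"
    and bounded: "\<And>\<phi>. \<phi> \<in> borel_measurable (vol k) \<Longrightarrow> lnorm k p \<alpha> \<phi> < \<infinity> \<Longrightarrow>
      lnorm k q \<beta> (S_op k a b c \<phi>) \<le> ennreal C * lnorm k p \<alpha> \<phi>"
  shows "- (q * a) < \<beta> + 1"
    and "c = real CARD('n) + a + b + (real CARD('n) + \<beta>) / q - (real CARD('n) + \<alpha>) / p"
proof -
  obtain \<phi> where [measurable]: "\<phi> \<in> borel_measurable (vol k)" and fin: "lnorm k p \<alpha> \<phi> < \<infinity>"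
    and pos: "lnorm k q \<beta> (S_op k a b c \<phi>) > 0"
    and aq: "lnorm k q \<beta> (S_op k a b c \<phi>) < \<infinity> \<Longrightarrow> a * q + \<beta> > - 1"
    using S_op_test_function[OF p q, of k \<alpha> \<beta> a b c] by metis
  have finS: "lnorm k q \<beta> (S_op k a b c \<phi>) < \<infinity>"
    using bounded[of \<phi>] fin by (auto intro: le_less_trans simp: ennreal_mult_less_top)
  then show "- (q * a) < \<beta> + 1" using aq by (simp add: mult.commute)
  obtain x where x: "lnorm k p \<alpha> \<phi> = ennreal x" "x \<ge> 0" using fin by (cases "lnorm k p \<alpha> \<phi>") auto
  obtain y where y: "lnorm k q \<beta> (S_op k a b c \<phi>) = ennreal y" "y > 0"
    using pos finS by (cases "lnorm k q \<beta> (S_op k a b c \<phi>)") (auto simp: ennreal_less_zero_iff)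
  \<comment> \<open>\<open>e\<close> is the homogeneity degree of the operator; \<open>s\<close> and
    \<open>t\<close> are the powers of r by which the norms of the image and of the test function
    grow under dilation.\<close>
  define e where "e = 2 * real CARD('n) + 2 * a + 2 * b - 2 * c"
  define s where "s = e + (2 * real CARD('n) + 2 * \<beta>) / q"
  define t where "t = (2 * real CARD('n) + 2 * \<alpha>) / p"
  have "r powr s \<le> (C * x / y) * r powr t" if r: "r > 0" for r
  proof -
    let ?\<phi> = "\<lambda>z. \<phi> (inverse r *\<^sub>R z)"
    have m: "?\<phi> \<in> borel_measurable (vol k)"
      using r by (intro measurable_compose[OF scaleR_measurable_vol]) auto
    have m': "(\<lambda>z. S_op k a b c \<phi> (inverse r *\<^sub>R z)) \<in> borel_measurable (vol k)"
      using r by (intro measurable_compose[OF scaleR_measurable_vol]) auto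
    have n: "lnorm k p \<alpha> ?\<phi> = ennreal (r powr t * x)"
      using lnorm_scaleR[of \<phi> k r p \<alpha>] r p x by (simp add: t_def ennreal_mult)
    have "S_op k a b c ?\<phi> z = complex_of_real (r powr e) * S_op k a b c \<phi> (inverse r *\<^sub>R z)"
      if "z \<in> tube k" for z
      using S_op_scaleR[of \<phi> k r "inverse r *\<^sub>R z" a b c] that r by (simp add: tube_scaleR e_def)
    then have "lnorm k q \<beta> (S_op k a b c ?\<phi>) =
        lnorm k q \<beta> (\<lambda>z. complex_of_real (r powr e) * S_op k a b c \<phi> (inverse r *\<^sub>R z))"
      by (rule lnorm_cong)
    also have "\<dots> = ennreal (r powr e) * (ennreal (r powr ((2 * real CARD('n) + 2 * \<beta>) / q)) * ennreal y)"
      using m' r q y(1) lnorm_scaleR[of "S_op k a b c \<phi>" k r q \<beta>]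
      by (simp add: lnorm_cmult)
    also have "\<dots> = ennreal (r powr s * y)"
      using y r by (simp add: s_def powr_add mult.assoc ennreal_mult)
    finally have "ennreal (r powr s * y) \<le> ennreal C * ennreal (r powr t * x)"
      using bounded[OF m] n by simp
    then have "r powr s * y \<le> C * (r powr t * x)"
      using C x by (simp add: ennreal_le_iff flip: ennreal_mult)
    then show ?thesis using y by (simp add: field_simps)
  qed
  then have "s = t" by (rule powr_le_imp_exponent_eq)
  moreover have "(2 * real CARD('n) + 2 * \<beta>) / q = 2 * ((real CARD('n) + \<beta>) / q)"
      "(2 * real CARD('n) + 2 * \<alpha>) / p = 2 * ((real CARD('n) + \<alpha>) / p)"
    by (simp_all add: add_divide_distrib)
  ultimately show "c = real CARD('n) + a + b + (real CARD('n) + \<beta>) / q - (real CARD('n) + \<alpha>) / p"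
    unfolding s_def t_def e_def by linarith
qed

section \<open>Descent from two variables to one\<close>

text \<open>Divides a fixed tensor factor out of a norm inequality, with a constant chosen before
  \<open>x\<close> and \<open>X\<close>. As \<open>y\<close> may be \<infinity>, the division is by
  a positive real \<open>v\<close> below it.\<close>

lemma ennreal_mult_le_cancel:
  fixes y Y :: ennreal
  assumes "y > 0" "Y < \<infinity>" "C \<ge> 0"
  obtains C' where "C' \<ge> 0" "\<And>x X. x * y \<le> ennreal C * (X * Y) \<Longrightarrow> x \<le> ennreal C' * X"
proof -
  obtain v where v: "v > 0" "ennreal v \<le> y"
  proof (cases y)
    case (real r)
    then show ?thesis using that[of r] assms by (auto simp: ennreal_less_zero_iff)
  qed (use that[of 1] in auto)
  obtain V where V: "Y = ennreal V" "V \<ge> 0" using assms by (cases Y) auto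
  show ?thesis
  proof (rule that[of "C * V / v"])
    fix x X assume le: "x * y \<le> ennreal C * (X * Y)"
    have "x = ennreal (1 / v) * (x * ennreal v)"
      using v by (simp add: mult.left_commute flip: ennreal_mult)
    also have "\<dots> \<le> ennreal (1 / v) * (ennreal C * (X * Y))"
      using v(2) le by (intro mult_left_mono order_trans[OF mult_left_mono le]) auto
    also have "\<dots> = (ennreal (1 / v) * ennreal C * ennreal V) * X"
      unfolding V by (simp only: mult_ac)
    also have "ennreal (1 / v) * ennreal C * ennreal V = ennreal (C * V / v)"
      using v V assms by (simp flip: ennreal_mult)
    finally show "x \<le> ennreal (C * V / v) * X" .
  qed (use v V assms in simp)
qed

lemma T_bounded_tensor:
  assumes T: "T_bounded k a b c p \<alpha> q \<beta>" and pq: "\<And>i. p $ i > 0" "\<And>i. q $ i > 0"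
  obtains C where "C \<ge> 0" "\<And>\<phi> \<psi>. \<phi> \<in> borel_measurable (vol k) \<Longrightarrow> \<psi> \<in> borel_measurable (vol k) \<Longrightarrow>
    lnorm k (p $ 1) (\<alpha> $ 1) \<phi> < \<infinity> \<Longrightarrow> lnorm k (p $ 2) (\<alpha> $ 2) \<psi> < \<infinity> \<Longrightarrow>
    lnorm k (q $ 1) (\<beta> $ 1) (S_op k (a $ 1) (b $ 1) (c $ 1) \<phi>) *
    lnorm k (q $ 2) (\<beta> $ 2) (S_op k (a $ 2) (b $ 2) (c $ 2) \<psi>)
    \<le> ennreal C * (lnorm k (p $ 1) (\<alpha> $ 1) \<phi> * lnorm k (p $ 2) (\<alpha> $ 2) \<psi>)"
proof -
  obtain C where C: "\<And>f. f \<in> mixed_space k p \<alpha> \<Longrightarrow>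
      mixed_norm k q \<beta> (T_op k a b c f) \<le> ennreal C * mixed_norm k p \<alpha> f"
    using T unfolding T_bounded_def by blast
  show ?thesis
  \<comment> \<open>The bound's constant may be negative; \<open>ennreal\<close> sends it to 0 then,
    so taking the maximum with 0 changes nothing.\<close>
  proof (rule that[of "max C 0"])
    fix \<phi> \<psi>
    assume [measurable]: "\<phi> \<in> borel_measurable (vol k)" "\<psi> \<in> borel_measurable (vol k)"
      and fin: "lnorm k (p $ 1) (\<alpha> $ 1) \<phi> < \<infinity>" "lnorm k (p $ 2) (\<alpha> $ 2) \<psi> < \<infinity>"
    let ?f = "\<lambda>(z, w). \<phi> z * \<psi> w"
    have norm: "mixed_norm k p \<alpha> ?f = lnorm k (p $ 1) (\<alpha> $ 1) \<phi> * lnorm k (p $ 2) (\<alpha> $ 2) \<psi>"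
      by (rule mixed_norm_tensor) (simp_all add: pq)
    have "mixed_norm k q \<beta> (T_op k a b c ?f) =
        lnorm k (q $ 1) (\<beta> $ 1) (S_op k (a $ 1) (b $ 1) (c $ 1) \<phi>) *
        lnorm k (q $ 2) (\<beta> $ 2) (S_op k (a $ 2) (b $ 2) (c $ 2) \<psi>)"
      unfolding T_op_tensor by (rule mixed_norm_tensor) (simp_all add: pq)
    moreover have "?f \<in> mixed_space k p \<alpha>"
      using fin by (simp add: mixed_space_def norm ennreal_mult_less_top)
    moreover have "ennreal (max C 0) = ennreal C"
      by (simp add: max_def ennreal_neg)
    ultimately show "lnorm k (q $ 1) (\<beta> $ 1) (S_op k (a $ 1) (b $ 1) (c $ 1) \<phi>) *
        lnorm k (q $ 2) (\<beta> $ 2) (S_op k (a $ 2) (b $ 2) (c $ 2) \<psi>)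
        \<le> ennreal (max C 0) * (lnorm k (p $ 1) (\<alpha> $ 1) \<phi> * lnorm k (p $ 2) (\<alpha> $ 2) \<psi>)"
      using C[of ?f] norm by simp
  qed simp
qed

text \<open>The other tensor factor is frozen at a test function of finite norm whose image has
  positive norm; dividing by these two fixed quantities leaves a bound in the variable
  \<open>i\<close> alone.\<close>

lemma T_bounded_imp_S_op_bounded:
  assumes T: "T_bounded k a b c p \<alpha> q \<beta>" and pq: "\<And>i. p $ i > 0" "\<And>i. q $ i > 0"
  obtains C where "C \<ge> 0" "\<And>\<phi>. \<phi> \<in> borel_measurable (vol k) \<Longrightarrow> lnorm k (p $ i) (\<alpha> $ i) \<phi> < \<infinity> \<Longrightarrow>
    lnorm k (q $ i) (\<beta> $ i) (S_op k (a $ i) (b $ i) (c $ i) \<phi>) \<le> ennreal C * lnorm k (p $ i) (\<alpha> $ i) \<phi>"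
proof -
  obtain C where C: "C \<ge> 0" and le: "\<And>\<phi> \<psi>. \<phi> \<in> borel_measurable (vol k) \<Longrightarrow> \<psi> \<in> borel_measurable (vol k) \<Longrightarrow>
    lnorm k (p $ 1) (\<alpha> $ 1) \<phi> < \<infinity> \<Longrightarrow> lnorm k (p $ 2) (\<alpha> $ 2) \<psi> < \<infinity> \<Longrightarrow>
    lnorm k (q $ 1) (\<beta> $ 1) (S_op k (a $ 1) (b $ 1) (c $ 1) \<phi>) *
    lnorm k (q $ 2) (\<beta> $ 2) (S_op k (a $ 2) (b $ 2) (c $ 2) \<psi>)
    \<le> ennreal C * (lnorm k (p $ 1) (\<alpha> $ 1) \<phi> * lnorm k (p $ 2) (\<alpha> $ 2) \<psi>)"
    using T_bounded_tensor[OF T pq] by metis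
  consider "i = 1" | "i = 2" using exhaust_2 by blast
  then show ?thesis
  proof cases
    case 1
    obtain \<psi> where \<psi>: "\<psi> \<in> borel_measurable (vol k)" "lnorm k (p $ 2) (\<alpha> $ 2) \<psi> < \<infinity>"
      "lnorm k (q $ 2) (\<beta> $ 2) (S_op k (a $ 2) (b $ 2) (c $ 2) \<psi>) > 0"
      using S_op_test_function[OF pq(1)[of 2] pq(2)[of 2], of k "\<alpha> $ 2" "\<beta> $ 2" "a $ 2" "b $ 2" "c $ 2"] by metis
    obtain C' where C': "C' \<ge> 0" and cancel: "\<And>x X. x * lnorm k (q $ 2) (\<beta> $ 2) (S_op k (a $ 2) (b $ 2) (c $ 2) \<psi>)
        \<le> ennreal C * (X * lnorm k (p $ 2) (\<alpha> $ 2) \<psi>) \<Longrightarrow> x \<le> ennreal C' * X"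
      using ennreal_mult_le_cancel[OF \<psi>(3,2) C] by metis
    show ?thesis
      using le[OF _ \<psi>(1) _ \<psi>(2)] unfolding 1 by (intro that[of C'] C' cancel) (simp_all add: 1)
  next
    case 2
    obtain \<psi> where \<psi>: "\<psi> \<in> borel_measurable (vol k)" "lnorm k (p $ 1) (\<alpha> $ 1) \<psi> < \<infinity>"
      "lnorm k (q $ 1) (\<beta> $ 1) (S_op k (a $ 1) (b $ 1) (c $ 1) \<psi>) > 0"
      using S_op_test_function[OF pq(1)[of 1] pq(2)[of 1], of k "\<alpha> $ 1" "\<beta> $ 1" "a $ 1" "b $ 1" "c $ 1"] by metis
    obtain C' where C': "C' \<ge> 0" and cancel: "\<And>x X. x * lnorm k (q $ 1) (\<beta> $ 1) (S_op k (a $ 1) (b $ 1) (c $ 1) \<psi>)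
        \<le> ennreal C * (X * lnorm k (p $ 1) (\<alpha> $ 1) \<psi>) \<Longrightarrow> x \<le> ennreal C' * X"
      using ennreal_mult_le_cancel[OF \<psi>(3,2) C] by metis
    show ?thesis
      using le[OF \<psi>(1) _ \<psi>(2)] unfolding 2
      by (intro that[of C'] C' cancel) (simp_all add: 2 mult.commute)
  qed
qed

theorem theorem1:
  fixes k :: "'n::finite"
    and p q a b c \<alpha> \<beta> :: "real^2"
  assumes "1 < min (p $ 1) (p $ 2)"
    and "max (p $ 1) (p $ 2) \<le> min (q $ 1) (q $ 2)"
    and "\<forall>i. \<alpha> $ i > -1"
    and "\<forall>i. \<beta> $ i > -1"
    and "T_bounded k a b c p \<alpha> q \<beta>"
  shows "\<forall>i.
      - (q $ i * a $ i) < \<beta> $ i + 1 \<and>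
      \<alpha> $ i + 1 < p $ i * (b $ i + 1) \<and>
      c $ i = real CARD('n) + a $ i + b $ i + (real CARD('n) + \<beta> $ i) / q $ i
                - (real CARD('n) + \<alpha> $ i) / p $ i"
proof
  fix i :: 2
  have p: "p $ i > 1" for i using assms(1) exhaust_2[of i] by auto
  have q: "q $ i > 1" for i using assms(1,2) exhaust_2[of i] by auto
  have pq0: "p $ i > 0" "q $ i > 0" for i
    using p[of i] q[of i] by linarith+
  obtain C where C: "C \<ge> 0" and bounded: "\<And>\<phi>. \<phi> \<in> borel_measurable (vol k) \<Longrightarrow>
      lnorm k (p $ i) (\<alpha> $ i) \<phi> < \<infinity> \<Longrightarrow>
      lnorm k (q $ i) (\<beta> $ i) (S_op k (a $ i) (b $ i) (c $ i) \<phi>) \<le> ennreal C * lnorm k (p $ i) (\<alpha> $ i) \<phi>"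
    using T_bounded_imp_S_op_bounded[OF assms(5) pq0] by metis
  show "- (q $ i * a $ i) < \<beta> $ i + 1 \<and>
      \<alpha> $ i + 1 < p $ i * (b $ i + 1) \<and>
      c $ i = real CARD('n) + a $ i + b $ i + (real CARD('n) + \<beta> $ i) / q $ i
                - (real CARD('n) + \<alpha> $ i) / p $ i"
    using S_op_bounded_imp_exponent[OF pq0 C bounded] S_op_bounded_imp_weight[OF p pq0(2) C bounded]
    by blast
qed

end
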